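(* Let $k\ge 3$ and let $n\ge 2$ be even. Given $n$ points in $[0,1]^k$, there exists a perfect matching $M$ of the $n$ points such that $$\left(\sum_{e\in M}|e|^k\right)^{1/k}\le 3\sqrt5\left(\tfrac13\right)^{1/k}\sqrt{k}.$$ For fixed $k$, such a matching $M$ can be computed in time proportional to that needed for computing a Euclidean minimum spanning tree of the points; in particular, in time subquadratic in $n$.
   Context: For an edge $e=xy$, $|e|=|x-y|$ is its Euclidean length. A perfect matching of the points is a partition of the $n$ points into $n/2$ pairs (edges). A Euclidean minimum spanning tree is a spanning tree of the complete graph on the points minimizing the sum of Euclidean edge lengths. Running times are in the standard real-number model of computational geometry. *)

theory Defs
  imports
    "HOL-Analysis.Analysis"
    "HOL-Library.Disjoint_Sets"
    "HOL-Library.Countable_Set"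
    "HOL-Library.Landau_Symbols"
begin

section \<open>Matchings and spanning trees on point sets\<close>

text \<open>An edge on a point set is a two-element subset of it.\<close>

definition unit_cube :: "(real ^ 'k) set" where
  "unit_cube = {x. \<forall>i. 0 \<le> x $ i \<and> x $ i \<le> 1}"

definition edge_length :: "(real ^ 'k) set \<Rightarrow> real" where
  "edge_length e = (THE d. \<exists>x y. e = {x, y} \<and> d = dist x y)"

lemma edge_length_pair [simp]: "edge_length {x, y} = dist x y"
  unfolding edge_length_def
  by (rule the_equality) (auto simp: doubleton_eq_iff dist_commute)

definition perfect_matching :: "'a set \<Rightarrow> 'a set set \<Rightarrow> bool" where
  "perfect_matching S M \<longleftrightarrow> partition_on S M \<and> (\<forall>e\<in>M. card e = 2)"

definition complete_edges :: "'a set \<Rightarrow> 'a set set" where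
  "complete_edges S = {e. e \<subseteq> S \<and> card e = 2}"

definition connected_graph :: "'a set \<Rightarrow> 'a set set \<Rightarrow> bool" where
  "connected_graph S E \<longleftrightarrow> S \<noteq> {} \<and> (\<forall>x\<in>S. \<forall>y\<in>S. (x, y) \<in> {(u, v). {u, v} \<in> E}\<^sup>*)"

definition graph_cycle :: "'a set set \<Rightarrow> 'a list \<Rightarrow> bool" where
  "graph_cycle E vs \<longleftrightarrow> length vs \<ge> 3 \<and> distinct vs \<and>
     (\<forall>i. Suc i < length vs \<longrightarrow> {vs ! i, vs ! Suc i} \<in> E) \<and> {last vs, hd vs} \<in> E"

definition spanning_tree :: "'a set \<Rightarrow> 'a set set \<Rightarrow> bool" where
  "spanning_tree S E \<longleftrightarrow>
     E \<subseteq> complete_edges S \<and> connected_graph S E \<and> (\<nexists>vs. graph_cycle E vs)"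

definition euclidean_mst :: "(real ^ 'k) set \<Rightarrow> (real ^ 'k) set set \<Rightarrow> bool" where
  "euclidean_mst S E \<longleftrightarrow> spanning_tree S E \<and>
     (\<forall>E'. spanning_tree S E' \<longrightarrow> (\<Sum>e\<in>E. edge_length e) \<le> (\<Sum>e\<in>E'. edge_length e))"

definition short_matching :: "(real ^ 'k) set \<Rightarrow> (real ^ 'k) set set \<Rightarrow> bool" where
  "short_matching S M \<longleftrightarrow> perfect_matching S M \<and>
     (\<Sum>e\<in>M. edge_length e ^ CARD('k)) powr (1 / real CARD('k))
       \<le> 3 * sqrt 5 * (1 / 3) powr (1 / real CARD('k)) * sqrt (real CARD('k))"


section \<open>The real random access machine\<close>

text \<open>
  The real-number model of computation, presented as a while language. The memory consists of
  integer arrays and arrays of exact reals; arrays are named by natural numbers, of which a program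
  mentions only finitely many, and are indexed by integers, so that indirect addressing is available.
  Real arithmetic is exact and consists of the four field operations and square root. There is no
  rounding and no other conversion from reals to integers, and program constants are integers, so a
  program cannot hide information in real constants. On integers there are only addition and
  subtraction (with multiplication, unit cost would no longer be a realistic measure).
\<close>

datatype iexp =
    IConst int
  | IGet nat iexp
  | IAdd iexp iexp
  | ISub iexp iexp

datatype rexp =
    RConst int
  | RGet nat iexp
  | RAdd rexp rexp
  | RSub rexp rexp
  | RMul rexp rexp
  | RDiv rexp rexp
  | RSqrt rexp

datatype bexp =
    ILess iexp iexp
  | RLess rexp rexp
  | BNot bexp
  | BAnd bexp bexp

datatype prog =
    IPut nat iexp iexp
  | RPut nat iexp rexp
  | Seq prog prog
  | If bexp prog prog
  | While bexp prog

record memory =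
  imem :: "nat \<Rightarrow> int \<Rightarrow> int"
  rmem :: "nat \<Rightarrow> int \<Rightarrow> real"

fun ival :: "iexp \<Rightarrow> memory \<Rightarrow> int" where
  "ival (IConst c) s = c"
| "ival (IGet a i) s = imem s a (ival i s)"
| "ival (IAdd x y) s = ival x s + ival y s"
| "ival (ISub x y) s = ival x s - ival y s"

text \<open>
  Division by zero and square roots of negative numbers take their usual HOL values. A program can
  test for these cases, so this convention does not add power.
\<close>

fun rval :: "rexp \<Rightarrow> memory \<Rightarrow> real" where
  "rval (RConst c) s = of_int c"
| "rval (RGet a i) s = rmem s a (ival i s)"
| "rval (RAdd x y) s = rval x s + rval y s"
| "rval (RSub x y) s = rval x s - rval y s"
| "rval (RMul x y) s = rval x s * rval y s"
| "rval (RDiv x y) s = rval x s / rval y s"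
| "rval (RSqrt x) s = sqrt (rval x s)"

fun bval :: "bexp \<Rightarrow> memory \<Rightarrow> bool" where
  "bval (ILess x y) s \<longleftrightarrow> ival x s < ival y s"
| "bval (RLess x y) s \<longleftrightarrow> rval x s < rval y s"
| "bval (BNot b) s \<longleftrightarrow> \<not> bval b s"
| "bval (BAnd b c) s \<longleftrightarrow> bval b s \<and> bval c s"

text \<open>
  \<open>runs p s t s'\<close>: started in \<open>s\<close>, the program \<open>p\<close> terminates in \<open>s'\<close> after \<open>t\<close> steps. Every
  executed assignment and every evaluated test counts as one step. The expressions occurring in a
  program have bounded size, so this agrees with charging each arithmetic operation and each memory
  access one unit up to a constant factor depending on the program only.
\<close>

inductive runs :: "prog \<Rightarrow> memory \<Rightarrow> nat \<Rightarrow> memory \<Rightarrow> bool" where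
  IPut: "runs (IPut a i x) s 1
    (s\<lparr>imem := (imem s)(a := (imem s a)(ival i s := ival x s))\<rparr>)"
| RPut: "runs (RPut a i x) s 1
    (s\<lparr>rmem := (rmem s)(a := (rmem s a)(ival i s := rval x s))\<rparr>)"
| Seq: "runs p s t s' \<Longrightarrow> runs q s' u s'' \<Longrightarrow> runs (Seq p q) s (t + u) s''"
| IfTrue: "bval b s \<Longrightarrow> runs p s t s' \<Longrightarrow> runs (If b p q) s (Suc t) s'"
| IfFalse: "\<not> bval b s \<Longrightarrow> runs q s t s' \<Longrightarrow> runs (If b p q) s (Suc t) s'"
| WhileFalse: "\<not> bval b s \<Longrightarrow> runs (While b p) s 1 s"
| WhileTrue: "bval b s \<Longrightarrow> runs p s t s' \<Longrightarrow> runs (While b p) s' u s'' \<Longrightarrow>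
    runs (While b p) s (Suc (t + u)) s''"


section \<open>Computing edge sets of point sets\<close>

text \<open>
  Input convention: the number \<open>n\<close> of points is in cell \<open>0\<close> of integer array \<open>0\<close>, and for \<open>i < n\<close> the
  coordinates of the \<open>i\<close>-th point are in the cells \<open>i\<close> of the real arrays \<open>0, \<dots>, k - 1\<close>. All other cells
  are \<open>0\<close>. The index type of the coordinates carries no order; the bijection from \<open>{..<k}\<close> is
  the one that the library provides for finite sets.
\<close>

definition input_memory :: "(real ^ 'k) list \<Rightarrow> memory" where
  "input_memory xs =
     \<lparr>imem = (\<lambda>a i. if a = 0 \<and> i = 0 then int (length xs) else 0),
      rmem = (\<lambda>a i. if a < CARD('k) \<and> 0 \<le> i \<and> i < int (length xs)
                     then (xs ! nat i) $ from_nat_into (UNIV :: 'k set) a else 0)\<rparr>"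

text \<open>
  Output convention: the edges are listed without repetition, the indices of the two endpoints of
  edge number \<open>j\<close> being in the cells \<open>j\<close> of the integer arrays \<open>1\<close> and \<open>2\<close>.
\<close>

definition outputs_edges :: "(real ^ 'k) list \<Rightarrow> memory \<Rightarrow> (real ^ 'k) set set \<Rightarrow> bool" where
  "outputs_edges xs s E \<longleftrightarrow>
     (\<forall>a\<in>{1, 2}. \<forall>j<card E. imem s a (int j) \<in> {0..<int (length xs)}) \<and>
     bij_betw (\<lambda>j. {xs ! nat (imem s 1 (int j)), xs ! nat (imem s 2 (int j))}) {..<card E} E"

text \<open>
  \<open>computes_within p N R T\<close>: for all \<open>n \<in> N\<close>, given any \<open>n\<close> distinct points of the unit cube in any
  order, \<open>p\<close> computes within \<open>T n\<close> steps an edge set that is related to the point set by \<open>R\<close>.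
\<close>

definition computes_within ::
  "prog \<Rightarrow> nat set \<Rightarrow> ((real ^ 'k) set \<Rightarrow> (real ^ 'k) set set \<Rightarrow> bool) \<Rightarrow> (nat \<Rightarrow> real) \<Rightarrow> bool" where
  "computes_within p N R T \<longleftrightarrow>
     (\<forall>xs :: (real ^ 'k) list. distinct xs \<and> set xs \<subseteq> unit_cube \<and> length xs \<in> N \<longrightarrow>
       (\<exists>t s E. runs p (input_memory xs) t s \<and> real t \<le> T (length xs) \<and>
                outputs_edges xs s E \<and> R (set xs) E))"

end

theory Submission
  imports Defs "HOL-Combinatorics.Permutations" "HOL-Real_Asymp.Real_Asymp"
begin

text \<open>
  Order the cells of a grid with \<open>3 ^ (k * m) \<ge> n\<close> cells along a Peano curve. Because the curve is
  Hoelder continuous with exponent \<open>1 / k\<close>, matching points within a cell and then the leftover points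
  of consecutive nonempty cells gives edges whose \<open>k\<close>-th powers are bounded by disjoint intervals of the
  parameter. Each digit of the index of a point is found with two comparisons, and buckets replace
  sorting, so this takes \<open>O(n log n)\<close> steps without a minimum spanning tree. It is nevertheless
  proportional to the time for such trees: a machine without conversion from reals to integers has at
  most \<open>2 ^ t\<close> outputs after \<open>t\<close> steps, whereas \<open>n\<close> points on a line, listed in all orders, need at
  least \<open>(n - 1)!\<close> different outputs.
\<close>

section \<open>The Peano curve\<close>

text \<open>Base three lets every cell be entered at one corner and left at the opposite one, so
  subdivision needs reflections but no permutation of coordinates. The constant arises as follows.
  Points whose indices differ by D > 0 lie in equal or consecutive cubes of the finest scale at
  which a cube holds at least D cells, hence in a box with sides 2, 1, ..., 1 in units of that cube.
  This gives sqrt (k + 3), and rounding D up to a power of \<open>3 ^ k\<close> gives a further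
  factor 3. Pairs inside a cell have D = 0 and are charged the cell diagonal instead; since there
  are at least n cells, these charges add up to at most \<open>sqrt k ^ k\<close>. For k \<ge> 3 the
  main term is at most sqrt 18 * sqrt k, and the margin up to 3 * sqrt 5 * sqrt k = sqrt 45 * sqrt k
  pays for the factor 1/3 and for the diagonals. The obstacle on the machine is the missing floor
  function: points are located level by level, at logarithmic depth. The same lack makes the lower
  bound possible, so that a spanning tree program enters only through its time bound and is never
  called.\<close>

definition digit :: "real \<Rightarrow> int" where
  "digit t = (if t < 1/3 then 0 else if t < 2/3 then 1 else 2)"

text \<open>The expanding map behind the curve: the slab around the point is stretched to the whole
  cube. Reflecting the middle slab in the other directions makes the end of each slab meet the start
  of the next.\<close>

definition advance :: "'a \<Rightarrow> ('a \<Rightarrow> real) \<Rightarrow> 'a \<Rightarrow> real" where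
  "advance c y = (\<lambda>c'. if c' = c then 3 * y c - of_int (digit (y c))
                       else if digit (y c) = 1 then 1 - y c' else y c')"

text \<open>The list names the direction of each cut. Intermediate cells may be boxes, so properties
  of the curve follow by induction on single cuts.\<close>

primrec peano :: "'a list \<Rightarrow> ('a \<Rightarrow> real) \<Rightarrow> int" where
  "peano [] y = 0"
| "peano (c # cs) y = digit (y c) * 3 ^ length cs + peano cs (advance c y)"

definition in_cube :: "('a \<Rightarrow> real) \<Rightarrow> bool" where
  "in_cube y \<longleftrightarrow> (\<forall>c. 0 \<le> y c \<and> y c \<le> 1)"

definition width :: "'a list \<Rightarrow> 'a \<Rightarrow> real" where
  "width cs c = (1/3) ^ count_list cs c"

lemma width_Nil [simp]: "width [] c = 1"
  and width_Cons: "width (c # cs) c' = (if c' = c then width cs c' / 3 else width cs c')"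
  by (simp_all add: width_def)

lemma digit_cases: "digit t = 0 \<or> digit t = 1 \<or> digit t = 2"
  by (simp add: digit_def)

lemma in_cube_advance: "in_cube y \<Longrightarrow> in_cube (advance c y)"
  by (auto simp: in_cube_def advance_def digit_def)

lemma peano_bounds: "0 \<le> peano cs y \<and> peano cs y < 3 ^ length cs"
proof (induction cs arbitrary: y)
  case (Cons c cs)
  from Cons[of "advance c y"] show ?case
    using digit_cases[of "y c"] by auto
qed simp

lemma peano_append:
  "peano (cs @ ds) y = peano cs y * 3 ^ length ds + peano ds (fold advance cs y)"
  by (induction cs arbitrary: y) (auto simp: algebra_simps power_add)

text \<open>Later cuts only append ternary digits, so division leads from a fine cell back to the
  coarse cell containing it.\<close>

lemma peano_append_div: "peano (cs @ ds) y div 3 ^ length ds = peano cs y"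
  using peano_bounds[of ds "fold advance cs y"] by (simp add: peano_append)

lemma mixed_radix_eq:
  fixes p p' B d d' :: int
  assumes "d * B + p = d' * B + p'" "0 \<le> p" "p < B" "0 \<le> p'" "p' < B"
  shows "d = d' \<and> p = p'"
proof -
  have "(d * B + p) div B = d" using assms(2,3) by simp
  moreover have "(d' * B + p') div B = d'" using assms(4,5) by simp
  ultimately have "d = d'" using assms(1) by simp
  with assms(1) show ?thesis by simp
qed

text \<open>Either the low part grows by one, or there is a carry and it drops from its maximum to
  zero. This becomes the case distinction for consecutive cells.\<close>

lemma mixed_radix_Suc:
  fixes p p' B d d' :: int
  assumes "d * B + p = d' * B + p' + 1" "0 \<le> p" "p < B" "0 \<le> p'" "p' < B"
  shows "d = d' \<and> p = p' + 1 \<or> d = d' + 1 \<and> p = 0 \<and> p' = B - 1"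
proof (cases "p' = B - 1")
  case True
  then have "d * B + p = (d' + 1) * B + 0" using assms by (simp add: algebra_simps)
  from mixed_radix_eq[OF this] assms True show ?thesis by auto
next
  case False
  from mixed_radix_eq[of d B p d' "p' + 1"] assms False show ?thesis by auto
qed

text \<open>Digits 0 and 2 involve no reflection, so the first cell stays at the origin and, in the
  next lemma, the last cell at the opposite corner. These two ends have to fit together at a
  carry.\<close>

lemma peano_zero_corner: "in_cube y \<Longrightarrow> peano cs y = 0 \<Longrightarrow> y c \<le> width cs c"
proof (induction cs arbitrary: y)
  case (Cons e cs)
  have *: "digit (y e) = 0" "peano cs (advance e y) = 0"
    using Cons.prems(2) peano_bounds[of cs "advance e y"] mixed_radix_eq[of "digit (y e)" "3 ^ length cs" "peano cs (advance e y)" 0 0]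
    by auto
  from Cons.IH[OF in_cube_advance[OF Cons.prems(1)] *(2)] *(1) show ?case
    by (auto simp: advance_def width_Cons)
qed (simp add: in_cube_def)

lemma peano_last_corner: "in_cube y \<Longrightarrow> peano cs y = 3 ^ length cs - 1 \<Longrightarrow> 1 - y c \<le> width cs c"
proof (induction cs arbitrary: y)
  case (Cons e cs)
  have *: "digit (y e) = 2" "peano cs (advance e y) = 3 ^ length cs - 1"
    using Cons.prems(2) peano_bounds[of cs "advance e y"] mixed_radix_eq[of "digit (y e)" "3 ^ length cs" "peano cs (advance e y)" 2 "3 ^ length cs - 1"]
    by auto
  from Cons.IH[OF in_cube_advance[OF Cons.prems(1)] *(2)] *(1) show ?case
    by (auto simp: advance_def width_Cons)
qed (simp add: in_cube_def)

lemma abs_diff_advance: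
  assumes "digit (x e) = digit (y e)"
  shows "\<bar>advance e x c - advance e y c\<bar> = (if c = e then 3 * \<bar>x c - y c\<bar> else \<bar>x c - y c\<bar>)"
  using assms by (auto simp: advance_def abs_if)

lemma peano_same_cell:
  "in_cube x \<Longrightarrow> in_cube y \<Longrightarrow> peano cs x = peano cs y \<Longrightarrow> \<bar>x c - y c\<bar> \<le> width cs c"
proof (induction cs arbitrary: x y)
  case Nil
  then have "0 \<le> x c" "x c \<le> 1" "0 \<le> y c" "y c \<le> 1" by (auto simp: in_cube_def)
  then show ?case by (simp add: abs_le_iff)
next
  case (Cons e cs)
  have *: "digit (x e) = digit (y e)" "peano cs (advance e x) = peano cs (advance e y)"
    using Cons.prems(3) peano_bounds[of cs "advance e x"] peano_bounds[of cs "advance e y"]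
      mixed_radix_eq[of "digit (x e)" "3 ^ length cs" "peano cs (advance e x)" "digit (y e)"]
    by auto
  from Cons.IH[OF in_cube_advance[OF Cons.prems(1)] in_cube_advance[OF Cons.prems(2)] *(2)]
  show ?case by (auto simp: abs_diff_advance[of x e y, OF *(1)] width_Cons split: if_splits)
qed

text \<open>Equal leading digits pass to the rescaled points. A carry places the points in the last
  cell of one slab and the first cell of the next; these share a facet, whence the factor 2 in one
  direction only.\<close>

lemma peano_consecutive_cells:
  "in_cube x \<Longrightarrow> in_cube y \<Longrightarrow> peano cs y = peano cs x + 1 \<Longrightarrow>
    \<exists>e. \<forall>c. \<bar>x c - y c\<bar> \<le> (if c = e then 2 else 1) * width cs c"
proof (induction cs arbitrary: x y)
  case (Cons e cs)
  let ?x = "advance e x" and ?y = "advance e y"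
  note cube = in_cube_advance[OF Cons.prems(1), of e] in_cube_advance[OF Cons.prems(2), of e]
  have "digit (y e) = digit (x e) \<and> peano cs ?y = peano cs ?x + 1 \<or>
      digit (y e) = digit (x e) + 1 \<and> peano cs ?y = 0 \<and> peano cs ?x = 3 ^ length cs - 1"
    using mixed_radix_Suc[of "digit (y e)" "3 ^ length cs" "peano cs ?y" "digit (x e)" "peano cs ?x"]
      Cons.prems(3) peano_bounds[of cs ?x] peano_bounds[of cs ?y] by auto
  then show ?case
  proof (elim disjE conjE)
    assume *: "digit (y e) = digit (x e)" "peano cs ?y = peano cs ?x + 1"
    from Cons.IH[OF cube *(2)] obtain e' where
      e': "\<And>c. \<bar>?x c - ?y c\<bar> \<le> (if c = e' then 2 else 1) * width cs c" by blast
    show ?thesis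
    proof (intro exI allI)
      fix c
      show "\<bar>x c - y c\<bar> \<le> (if c = e' then 2 else 1) * width (e # cs) c"
        using e'[of c] by (auto simp: abs_diff_advance[of x e y, OF *(1)[symmetric]] width_Cons split: if_splits)
    qed
  next
    assume *: "digit (y e) = digit (x e) + 1" "peano cs ?y = 0" "peano cs ?x = 3 ^ length cs - 1"
    show ?thesis
    proof (intro exI allI)
      fix c
      have "?y c \<le> width cs c" "1 - ?x c \<le> width cs c"
        using peano_zero_corner[OF cube(2) *(2)] peano_last_corner[OF cube(1) *(3)] by auto
      moreover have "0 \<le> ?y c" "?x c \<le> 1" using cube by (auto simp: in_cube_def)
      \<comment> \<open>Exactly one of two successive digits is 1, so exactly one of the points is
        reflected. In directions other than \<open>e\<close> this brings both points to the same
        side of the cube.\<close>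
      moreover have "digit (x e) = 0 \<and> digit (y e) = 1 \<or> digit (x e) = 1 \<and> digit (y e) = 2"
        using *(1) digit_cases[of "x e"] digit_cases[of "y e"] by linarith
      ultimately show "\<bar>x c - y c\<bar> \<le> (if c = e then 2 else 1) * width (e # cs) c"
        unfolding abs_le_iff width_Cons advance_def
        by (elim disjE conjE; cases "c = e"; simp)
    qed
  qed
qed simp

section \<open>Cubical grids and Euclidean distance\<close>

definition sweep :: "nat \<Rightarrow> nat \<Rightarrow> nat list" where
  "sweep k m = concat (replicate m [0..<k])"

lemma length_sweep [simp]: "length (sweep k m) = k * m"
  by (induction m) (auto simp: sweep_def)

lemma sweep_add: "sweep k (m + l) = sweep k m @ sweep k l"
  by (simp add: sweep_def replicate_add)

lemma width_sweep: "c < k \<Longrightarrow> width (sweep k m) c = (1/3) ^ m"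
proof -
  assume c: "c < k"
  have 1: "count_list [0..<k] c = 1"
    using c by (induction k) (auto simp: count_list_0_iff less_Suc_eq)
  have "count_list (sweep k m) c = m"
    by (induction m) (use 1 in \<open>simp_all add: sweep_def\<close>)
  then show ?thesis by (simp add: width_def)
qed

text \<open>Coordinates are numbered as in the input arrays. Beyond the dimension
  \<open>from_nat_into\<close> still returns some coordinate, so \<open>in_cube\<close> holds for
  all arguments.\<close>

definition coords :: "real ^ 'k \<Rightarrow> nat \<Rightarrow> real" where
  "coords x c = x $ from_nat_into UNIV c"

lemma in_cube_coords: "x \<in> unit_cube \<Longrightarrow> in_cube (coords x)"
  by (simp add: in_cube_def unit_cube_def coords_def)

lemma dist_coords:
  fixes x y :: "real ^ 'k::finite"
  shows "(dist x y)\<^sup>2 = (\<Sum>c<CARD('k). (coords x c - coords y c)\<^sup>2)"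
proof -
  have "bij_betw (from_nat_into (UNIV :: 'k set)) {..<CARD('k)} UNIV"
    by (simp add: bij_betw_from_nat_into_finite)
  then have "(\<Sum>c<CARD('k). (coords x c - coords y c)\<^sup>2) = (\<Sum>i\<in>UNIV. (x $ i - y $ i)\<^sup>2)"
    unfolding coords_def by (rule sum.reindex_bij_betw)
  then show ?thesis
    by (simp add: dist_norm norm_vec_def L2_set_def sum_nonneg)
qed

lemma dist_same_cell:
  fixes x y :: "real ^ 'k::finite"
  assumes "x \<in> unit_cube" "y \<in> unit_cube"
    and "peano (sweep CARD('k) m) (coords x) = peano (sweep CARD('k) m) (coords y)"
  shows "dist x y \<le> sqrt (real CARD('k)) * (1/3) ^ m"
proof -
  have "(coords x c - coords y c)\<^sup>2 \<le> ((1/3)^m)\<^sup>2" if "c < CARD('k)" for c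
    using peano_same_cell[OF in_cube_coords[OF assms(1)] in_cube_coords[OF assms(2)] assms(3), of c]
      width_sweep[OF that, of m]
    by (simp add: abs_le_square_iff[symmetric])
  then have "(dist x y)\<^sup>2 \<le> (\<Sum>c<CARD('k). ((1/3)^m)\<^sup>2)"
    unfolding dist_coords by (intro sum_mono) auto
  also have "\<dots> = (sqrt (real CARD('k)) * (1/3) ^ m)\<^sup>2"
    by (simp add: power_mult_distrib)
  finally show ?thesis by (rule power2_le_imp_le) simp
qed

lemma dist_consecutive_cells:
  fixes x y :: "real ^ 'k::finite"
  assumes "x \<in> unit_cube" "y \<in> unit_cube"
    and "peano (sweep CARD('k) m) (coords y) = peano (sweep CARD('k) m) (coords x) + 1"
  shows "dist x y \<le> sqrt (real CARD('k) + 3) * (1/3) ^ m"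
proof -
  obtain e where e: "\<And>c. \<bar>coords x c - coords y c\<bar> \<le>
      (if c = e then 2 else 1) * width (sweep CARD('k) m) c"
    using peano_consecutive_cells[OF in_cube_coords[OF assms(1)] in_cube_coords[OF assms(2)] assms(3)]
    by blast
  define w :: real where "w = (1/3) ^ m"
  \<comment> \<open>Squared sides 4, 1, ..., 1, written as 1 everywhere plus 3 at \<open>e\<close>.
    An \<open>e\<close> beyond the dimension only lowers the sum.\<close>
  have "(coords x c - coords y c)\<^sup>2 \<le> w\<^sup>2 + (if c = e then 3 * w\<^sup>2 else 0)" if "c < CARD('k)" for c
  proof -
    have "\<bar>coords x c - coords y c\<bar> \<le> \<bar>(if c = e then 2 else 1) * w\<bar>"
      using e[of c] width_sweep[OF that, of m] by (auto simp: w_def)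
    then have "(coords x c - coords y c)\<^sup>2 \<le> ((if c = e then 2 else 1) * w)\<^sup>2"
      by (simp add: abs_le_square_iff)
    then show ?thesis by (auto simp: power_mult_distrib)
  qed
  then have "(dist x y)\<^sup>2 \<le> (\<Sum>c<CARD('k). w\<^sup>2 + (if c = e then 3 * w\<^sup>2 else 0))"
    unfolding dist_coords by (intro sum_mono) auto
  also have "\<dots> \<le> (real CARD('k) + 3) * w\<^sup>2"
    by (simp add: sum.distrib sum.delta algebra_simps)
  also have "\<dots> = (sqrt (real CARD('k) + 3) * (1/3) ^ m)\<^sup>2"
    by (simp add: power_mult_distrib w_def)
  finally show ?thesis by (rule power2_le_imp_le) simp
qed

text \<open>Aligned blocks of \<open>3 ^ (k * l)\<close> successive cells are cubes of the grid of
  depth \<open>m - l\<close>. A gap no longer than a block leads at most into the next block, and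
  the smallest sufficient block exceeds the gap at most by the factor \<open>3 ^ k\<close>, which is
  the 3 in front of the root.\<close>

lemma dist_peano_less:
  fixes x y :: "real ^ 'k::finite"
  assumes "x \<in> unit_cube" "y \<in> unit_cube"
    and less: "peano (sweep CARD('k) m) (coords x) < peano (sweep CARD('k) m) (coords y)"
  defines "D \<equiv> peano (sweep CARD('k) m) (coords y) - peano (sweep CARD('k) m) (coords x)"
  shows "dist x y ^ CARD('k) \<le>
    (3 * sqrt (real CARD('k) + 3)) ^ CARD('k) * of_int D / 3 ^ (CARD('k) * m)"
proof -
  define k where "k = CARD('k)"
  have k: "k > 0" by (simp add: k_def)
  let ?g = "\<lambda>m x. peano (sweep k m) (coords x)"
  have D: "D = ?g m y - ?g m x" by (simp add: D_def k_def)
  have D1: "1 \<le> D" using less by (simp add: D_def)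
  have Dm: "D \<le> 3 ^ (k * m)"
    using peano_bounds[of "sweep k m" "coords y"] peano_bounds[of "sweep k m" "coords x"]
    by (simp add: D)
  define l where "l = (LEAST l. D \<le> 3 ^ (k * l))"
  have l: "D \<le> 3 ^ (k * l)" unfolding l_def using Dm by (rule LeastI)
  have lm: "l \<le> m" unfolding l_def using Dm by (rule Least_le)
  have l': "3 ^ (k * l) \<le> 3 ^ k * D"
  proof (cases l)
    case 0
    have "1 * 1 \<le> 3 ^ k * D" by (rule mult_mono) (use D1 in auto)
    then show ?thesis using 0 by simp
  next
    case (Suc i)
    then have "\<not> D \<le> 3 ^ (k * i)"
      using not_less_Least[of i "\<lambda>l. D \<le> 3 ^ (k * l)"] by (simp add: l_def)
    then show ?thesis by (simp add: Suc power_add)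
  qed
  let ?B = "3 ^ (k * l) :: int"
  have coarse: "?g m z div ?B = ?g (m - l) z" for z :: "real ^ 'k"
    using peano_append_div[of "sweep k (m - l)" "sweep k l" "coords z"] lm
    by (simp add: sweep_add[symmetric])
  have "?g (m - l) y = ?g (m - l) x \<or> ?g (m - l) y = ?g (m - l) x + 1"
  proof -
    have "?g m x div ?B \<le> ?g m y div ?B"
      by (rule zdiv_mono1) (use D D1 in auto)
    moreover have "?g m y div ?B \<le> (?g m x + ?B) div ?B"
      by (rule zdiv_mono1) (use D l in auto)
    moreover have "(?g m x + ?B) div ?B = ?g m x div ?B + 1"
      by simp
    ultimately show ?thesis unfolding coarse by linarith
  qed
  then have "dist x y \<le> sqrt (real k + 3) * (1/3) ^ (m - l)"
  proof
    assume "?g (m - l) y = ?g (m - l) x"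
    then have "dist x y \<le> sqrt (real k) * (1/3) ^ (m - l)"
      unfolding k_def by (intro dist_same_cell assms) simp
    also have "\<dots> \<le> sqrt (real k + 3) * (1/3) ^ (m - l)"
      by (intro mult_right_mono) auto
    finally show ?thesis .
  next
    assume "?g (m - l) y = ?g (m - l) x + 1"
    then show ?thesis unfolding k_def by (intro dist_consecutive_cells assms)
  qed
  then have "dist x y ^ k \<le> (sqrt (real k + 3) * (1/3) ^ (m - l)) ^ k"
    by (rule power_mono) simp
  also have "\<dots> = sqrt (real k + 3) ^ k * (3 ^ (k * l) / 3 ^ (k * m))"
  proof -
    have "(1/3) ^ ((m - l) * k) = (3 ^ (k * l) / 3 ^ (k * m) :: real)"
    proof -
      have "k * m = k * l + (m - l) * k" using lm by (simp add: algebra_simps)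
      then show ?thesis by (simp add: power_add power_one_over)
    qed
    then show ?thesis by (simp add: power_mult_distrib power_mult[symmetric])
  qed
  also have "\<dots> \<le> sqrt (real k + 3) ^ k * ((3 ^ k * of_int D) / 3 ^ (k * m))"
  proof -
    have "of_int (3 ^ (k * l)) \<le> (of_int (3 ^ k * D) :: real)"
      using l' by (simp only: of_int_le_iff)
    then have "(3 ^ (k * l) :: real) \<le> 3 ^ k * of_int D" by simp
    then show ?thesis by (intro mult_left_mono divide_right_mono) auto
  qed
  finally show ?thesis by (simp add: k_def power_mult_distrib mult_ac)
qed

text \<open>Points of one cell have no gap to pay for their distance; the extra summand is the
  \<open>k\<close>-th power of the cell diagonal.\<close>

lemma dist_peano:
  fixes x y :: "real ^ 'k::finite" and m :: nat
  assumes "x \<in> unit_cube" "y \<in> unit_cube"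
  defines "D \<equiv> \<bar>peano (sweep CARD('k) m) (coords x) - peano (sweep CARD('k) m) (coords y)\<bar>"
  shows "dist x y ^ CARD('k) \<le>
    ((3 * sqrt (real CARD('k) + 3)) ^ CARD('k) * of_int D + sqrt (real CARD('k)) ^ CARD('k))
      / 3 ^ (CARD('k) * m)"
proof -
  let ?k = "CARD('k)"
  let ?gx = "peano (sweep ?k m) (coords x)" and ?gy = "peano (sweep ?k m) (coords y)"
  have *: "(3 * sqrt (real ?k + 3)) ^ ?k * of_int D / 3 ^ (?k * m)
      \<le> ((3 * sqrt (real ?k + 3)) ^ ?k * of_int D + sqrt (real ?k) ^ ?k) / 3 ^ (?k * m)"
    by (intro divide_right_mono) auto
  consider "?gx < ?gy" | "?gy < ?gx" | "?gx = ?gy" by linarith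
  then show ?thesis
  proof cases
    case 1
    from order_trans[OF dist_peano_less[OF assms(1,2) 1] _] * 1 show ?thesis by (simp add: D_def)
  next
    case 2
    from order_trans[OF dist_peano_less[OF assms(2,1) 2] _] * 2 show ?thesis
      by (simp add: D_def dist_commute)
  next
    case 3
    have "dist x y ^ ?k \<le> (sqrt (real ?k) * (1/3) ^ m) ^ ?k"
      by (rule power_mono[OF dist_same_cell[OF assms(1,2) 3]]) simp
    also have "\<dots> = sqrt (real ?k) ^ ?k / 3 ^ (?k * m)"
      by (simp add: power_mult_distrib power_mult[symmetric] power_one_over power_divide mult.commute)
    finally show ?thesis using 3 by (simp add: D_def)
  qed
qed

section \<open>The constant of the matching bound\<close>

lemma sqrt_power_gap:
  assumes "k \<ge> 3"
  shows "3 * (sqrt 18 ^ k + 1) \<le> sqrt 45 ^ k"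
  using assms
proof (induction rule: dec_induct)
  case base
  \<comment> \<open>These rational bounds reduce the claim to 232.5 \<le> 301.5. At exponent 2 the
    inequality fails, with 57 against 45.\<close>
  have "sqrt 18 \<le> sqrt ((17/4)\<^sup>2)" "sqrt ((67/10)\<^sup>2) \<le> sqrt 45"
    by (intro real_sqrt_le_mono; simp add: power2_eq_square)+
  then have "sqrt 18 \<le> 17/4" "67/10 \<le> sqrt 45" by simp_all
  moreover have "sqrt 18 ^ 3 = 18 * sqrt 18" "sqrt 45 ^ 3 = 45 * sqrt 45"
    by (simp_all add: power3_eq_cube)
  ultimately show ?case by simp
next
  case (step k)
  have "3 * (sqrt 18 ^ Suc k + 1) \<le> sqrt 18 * (3 * (sqrt 18 ^ k + 1))"
    by (simp add: algebra_simps)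
  also have "\<dots> \<le> sqrt 45 * (sqrt 45 ^ k)"
    by (rule mult_mono) (use step.IH in auto)
  finally show ?case by simp
qed

lemma matching_constant:
  assumes "k \<ge> 3"
  shows "(3 * sqrt (real k + 3)) ^ k + sqrt (real k) ^ k \<le> 1 / 3 * (3 * sqrt 5 * sqrt (real k)) ^ k"
proof -
  have "3 * sqrt (real k + 3) \<le> sqrt 18 * sqrt (real k)"
  proof -
    \<comment> \<open>Here \<open>k \<ge> 3\<close> enters as
      \<open>k + 3 \<le> 2 * k\<close>.\<close>
    have "sqrt (9 * (real k + 3)) \<le> sqrt (18 * real k)"
      using assms by (intro real_sqrt_le_mono) auto
    moreover have "sqrt (9 * (real k + 3)) = 3 * sqrt (real k + 3)"
      by (simp only: real_sqrt_mult) simp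
    ultimately show ?thesis by (simp add: real_sqrt_mult)
  qed
  then have "(3 * sqrt (real k + 3)) ^ k \<le> (sqrt 18 * sqrt (real k)) ^ k"
    by (rule power_mono) simp
  then have "(3 * sqrt (real k + 3)) ^ k + sqrt (real k) ^ k
      \<le> 1 / 3 * (3 * (sqrt 18 ^ k + 1)) * sqrt (real k) ^ k"
    by (simp add: power_mult_distrib algebra_simps)
  also have "\<dots> \<le> 1 / 3 * sqrt 45 ^ k * sqrt (real k) ^ k"
    using sqrt_power_gap[OF assms] by (intro mult_right_mono) auto
  also have "sqrt 45 = 3 * sqrt 5"
    using real_sqrt_mult[of 9 5] by simp
  finally show ?thesis by (simp add: power_mult_distrib mult.assoc)
qed

text \<open>Summing \<open>dist_peano\<close> charges every gap once and one cell diagonal per edge.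
  Both the total gap and the number of edges are at most the number of cells, so the grid size
  cancels.\<close>

lemma peano_matching_cost:
  fixes es :: "((real ^ 'k::finite) \<times> (real ^ 'k)) list"
  assumes k: "CARD('k) \<ge> 3"
    and cube: "\<And>x y. (x, y) \<in> set es \<Longrightarrow> x \<in> unit_cube \<and> y \<in> unit_cube"
    and len: "int (length es) \<le> 3 ^ (CARD('k) * m)"
    and gaps: "(\<Sum>(x, y)\<leftarrow>es. \<bar>peano (sweep CARD('k) m) (coords x) - peano (sweep CARD('k) m) (coords y)\<bar>)
        \<le> 3 ^ (CARD('k) * m)"
  shows "(\<Sum>(x, y)\<leftarrow>es. dist x y ^ CARD('k)) \<le> 1 / 3 * (3 * sqrt 5 * sqrt (real CARD('k))) ^ CARD('k)"
proof -
  define k where "k = CARD('k)"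
  let ?N = "3 ^ (k * m) :: real"
  let ?A = "(3 * sqrt (real k + 3)) ^ k" and ?C = "sqrt (real k) ^ k"
  define D where "D = (\<lambda>(x :: real ^ 'k, y :: real ^ 'k). \<bar>peano (sweep k m) (coords x) - peano (sweep k m) (coords y)\<bar>)"
  have "(\<Sum>(x, y)\<leftarrow>es. dist x y ^ k) \<le> (\<Sum>e\<leftarrow>es. (?A * of_int (D e) + ?C) / ?N)"
    using dist_peano[where 'k = 'k and m = m] cube
    by (intro sum_list_mono) (auto simp: D_def k_def)
  also have "\<dots> = (?A * of_int (\<Sum>e\<leftarrow>es. D e) + ?C * real (length es)) / ?N"
    by (induction es) (simp_all add: add_divide_distrib distrib_left algebra_simps)
  also have "\<dots> \<le> (?A * ?N + ?C * ?N) / ?N"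
  proof -
    have "of_int (\<Sum>e\<leftarrow>es. D e) \<le> (of_int (3 ^ (k * m)) :: real)"
      using gaps by (simp only: of_int_le_iff D_def k_def)
    moreover have "of_int (int (length es)) \<le> (of_int (3 ^ (k * m)) :: real)"
      using len by (simp only: of_int_le_iff k_def)
    ultimately show ?thesis by (intro divide_right_mono add_mono mult_left_mono) auto
  qed
  also have "\<dots> = ?A + ?C" by (simp add: field_simps)
  also have "\<dots> \<le> 1 / 3 * (3 * sqrt 5 * sqrt (real k)) ^ k"
    using matching_constant k by (simp add: k_def)
  finally show ?thesis by (simp add: k_def)
qed

lemma cost_root_bound:
  fixes s c :: real and k :: nat
  assumes "k > 0" "0 \<le> s" "0 < c" "s \<le> 1 / 3 * c ^ k"
  shows "s powr (1 / real k) \<le> c * (1 / 3) powr (1 / real k)"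
proof -
  have "s powr (1 / real k) \<le> (1 / 3 * c ^ k) powr (1 / real k)"
    using assms by (intro powr_mono2) auto
  also have "\<dots> = (1 / 3) powr (1 / real k) * (c ^ k) powr (1 / real k)"
    by (rule powr_mult)
  also have "(c ^ k) powr (1 / real k) = c"
    using assms by (simp add: powr_realpow[symmetric] powr_powr)
  finally show ?thesis by (simp add: mult.commute)
qed

section \<open>Programs with time bounds\<close>

text \<open>A weakest precondition with a time budget. The memory comes last so that
  \<open>achieves q u Q\<close> can itself be a postcondition.\<close>

definition achieves :: "prog \<Rightarrow> nat \<Rightarrow> (memory \<Rightarrow> bool) \<Rightarrow> memory \<Rightarrow> bool" where
  "achieves p t Q s \<longleftrightarrow> (\<exists>u s'. runs p s u s' \<and> u \<le> t \<and> Q s')"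

lemma achieves_mono:
  "achieves p t Q s \<Longrightarrow> (\<And>s'. Q s' \<Longrightarrow> Q' s') \<Longrightarrow> t \<le> t' \<Longrightarrow> achieves p t' Q' s"
  unfolding achieves_def by (meson order_trans)

lemma achieves_IPut:
  "Q (s\<lparr>imem := (imem s)(a := (imem s a)(ival i s := ival x s))\<rparr>) \<Longrightarrow> 1 \<le> t \<Longrightarrow>
    achieves (IPut a i x) t Q s"
  unfolding achieves_def using runs.IPut by blast

lemma achieves_RPut:
  "Q (s\<lparr>rmem := (rmem s)(a := (rmem s a)(ival i s := rval x s))\<rparr>) \<Longrightarrow> 1 \<le> t \<Longrightarrow>
    achieves (RPut a i x) t Q s"
  unfolding achieves_def using runs.RPut by blast

lemma achieves_Seq:
  assumes "achieves p t (achieves q u Q) s" "t + u \<le> v"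
  shows "achieves (Seq p q) v Q s"
proof -
  obtain t' s' u' s'' where "runs p s t' s'" "t' \<le> t" "runs q s' u' s''" "u' \<le> u" "Q s''"
    using assms(1) unfolding achieves_def by blast
  moreover from this have "runs (Seq p q) s (t' + u') s''" by (auto intro: runs.Seq)
  ultimately show ?thesis
    unfolding achieves_def using assms(2) by (intro exI[of _ "t' + u'"] exI[of _ s'']) auto
qed

lemma achieves_If:
  assumes "bval b s \<Longrightarrow> achieves p t Q s" "\<not> bval b s \<Longrightarrow> achieves q t Q s" "Suc t \<le> v"
  shows "achieves (If b p q) v Q s"
proof (cases "bval b s")
  case True
  then obtain u s' where "runs p s u s'" "u \<le> t" "Q s'" using assms(1) by (auto simp: achieves_def)
  with True assms(3) show ?thesis
    unfolding achieves_def by (intro exI[of _ "Suc u"] exI[of _ s']) (auto intro: runs.IfTrue)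
next
  case False
  then obtain u s' where "runs q s u s'" "u \<le> t" "Q s'" using assms(2) by (auto simp: achieves_def)
  with False assms(3) show ?thesis
    unfolding achieves_def by (intro exI[of _ "Suc u"] exI[of _ s']) (auto intro: runs.IfFalse)
qed

text \<open>The number of rounds of every loop below is known beforehand; an invariant indexed by
  the round then yields termination and the time bound at once.\<close>

lemma achieves_While:
  assumes body: "\<And>i s. i < m \<Longrightarrow> Inv i s \<Longrightarrow> bval b s \<and> achieves p t (Inv (Suc i)) s"
    and exit: "\<And>s. Inv m s \<Longrightarrow> \<not> bval b s"
    and start: "Inv 0 s" and v: "m * (t + 1) + 1 \<le> v"
  shows "achieves (While b p) v (Inv m) s"
proof -
  have "achieves (While b p) ((m - i) * (t + 1) + 1) (Inv m) s" if "i \<le> m" "Inv i s" for i s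
    using that
  proof (induction "m - i" arbitrary: i s)
    case 0
    then have "i = m" by simp
    with 0 exit have "runs (While b p) s 1 s" by (intro runs.WhileFalse) auto
    with 0 \<open>i = m\<close> show ?case unfolding achieves_def by fastforce
  next
    case (Suc d)
    then have im: "i < m" by simp
    from body[OF im Suc.prems(2)] obtain u s' where
      1: "bval b s" "runs p s u s'" "u \<le> t" "Inv (Suc i) s'" by (auto simp: achieves_def)
    have "achieves (While b p) ((m - Suc i) * (t + 1) + 1) (Inv m) s'"
      using Suc.hyps(2) 1(4) im by (intro Suc.hyps(1)) auto
    then obtain w s'' where
      2: "runs (While b p) s' w s''" "w \<le> (m - Suc i) * (t + 1) + 1" "Inv m s''"
      by (auto simp: achieves_def)
    have "runs (While b p) s (Suc (u + w)) s''" using 1 2 by (auto intro: runs.WhileTrue)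
    moreover have "m - i = Suc (m - Suc i)" using im by simp
    then have "Suc (u + w) \<le> (m - i) * (t + 1) + 1" using 1(3) 2(2) by simp
    ultimately show ?case using 2(3) unfolding achieves_def by blast
  qed
  from this[of 0 s] start v show ?thesis by (auto intro: achieves_mono)
qed

section \<open>The matching program\<close>

abbreviation ivar :: "nat \<Rightarrow> iexp" where
  "ivar a \<equiv> IGet a (IConst 0)"

abbreviation iset :: "nat \<Rightarrow> iexp \<Rightarrow> prog" where
  "iset a x \<equiv> IPut a (IConst 0) x"

text \<open>Integers cannot be multiplied on the machine.\<close>

definition times3 :: "iexp \<Rightarrow> iexp" where
  "times3 x = IAdd x (IAdd x x)"

text \<open>The language has no empty program, so a chain over a list ends in the program
  \<open>q\<close> that follows it.\<close>

definition flip_coords :: "nat list \<Rightarrow> prog \<Rightarrow> prog" where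
  "flip_coords cs q = foldr Seq (map (\<lambda>c. RPut c (ivar 7) (RSub (RConst 1) (RGet c (ivar 7)))) cs) q"

text \<open>Comparing three times the coordinate with 1 and 2 keeps the constants integral. The
  digit is appended to the index in array 3.\<close>

definition advance_prog :: "nat \<Rightarrow> nat \<Rightarrow> prog" where
  "advance_prog k c = (
     let y = RMul (RConst 3) (RGet c (ivar 7));
         put = (\<lambda>d. IPut 3 (ivar 7) (IAdd (times3 (IGet 3 (ivar 7))) (IConst d)))
     in If (RLess y (RConst 1))
          (Seq (RPut c (ivar 7) y) (put 0))
          (If (RLess y (RConst 2))
             (Seq (RPut c (ivar 7) (RSub y (RConst 1))) (flip_coords (filter (\<lambda>c'. c' \<noteq> c) [0..<k]) (put 1)))
             (Seq (RPut c (ivar 7) (RSub y (RConst 2))) (put 2))))"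

definition sweep_prog :: "nat \<Rightarrow> prog" where
  "sweep_prog k = foldr Seq (map (advance_prog k) [0..<k]) (iset 7 (IAdd (ivar 7) (IConst 1)))"

definition refine_prog :: "nat \<Rightarrow> prog" where
  "refine_prog k = foldr Seq (replicate k (iset 6 (times3 (ivar 6))))
     (Seq (iset 7 (IConst 0)) (While (ILess (ivar 7) (ivar 0)) (sweep_prog k)))"

text \<open>A slot keeps at most one unmatched point: a newcomer is paired with the occupant, if
  any, and waits otherwise. The same step serves inside cells and between cells.\<close>

definition toggle :: "nat \<Rightarrow> iexp \<Rightarrow> iexp \<Rightarrow> prog" where
  "toggle a i x = If (ILess (IConst 0) (IGet a i))
     (Seq (IPut 1 (ivar 10) (ISub (IGet a i) (IConst 1)))
       (Seq (IPut 2 (ivar 10) (ISub x (IConst 1)))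
         (Seq (iset 10 (IAdd (ivar 10) (IConst 1))) (IPut a i (IConst 0)))))
     (IPut a i x)"

definition bucket_prog :: prog where
  "bucket_prog = Seq (toggle 4 (IGet 3 (ivar 7)) (IAdd (ivar 7) (IConst 1)))
     (iset 7 (IAdd (ivar 7) (IConst 1)))"

text \<open>Increasing bucket numbers follow the curve, so the single slot in array 9 joins
  leftovers of successive nonempty cells.\<close>

definition empty_prog :: prog where
  "empty_prog = If (ILess (IConst 0) (IGet 4 (ivar 8)))
     (Seq (toggle 9 (IConst 0) (IGet 4 (ivar 8))) (iset 8 (IAdd (ivar 8) (IConst 1))))
     (iset 8 (IAdd (ivar 8) (IConst 1)))"

text \<open>Integer arrays besides input and output: \<open>3\<close> the Peano indices of the points, \<open>4\<close> the buckets, \<open>6\<close>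
  the number of cells, \<open>7\<close> and \<open>8\<close> the loop counters, \<open>9\<close> the waiting point plus one, \<open>10\<close> the number
  of edges found so far. Points are mapped forward by the Peano dynamics in place.\<close>

definition matching_prog :: "nat \<Rightarrow> prog" where
  "matching_prog k =
     Seq (iset 6 (IConst 1))
    (Seq (While (ILess (ivar 6) (ivar 0)) (refine_prog k))
    (Seq (iset 7 (IConst 0))
    (Seq (While (ILess (ivar 7) (ivar 0)) bucket_prog)
         (While (ILess (ivar 8) (ivar 6)) empty_prog))))"

section \<open>Correctness of the index computation\<close>

lemma achieves_flip_coords:
  assumes "distinct cs"
    and "achieves q t Q (s\<lparr>rmem := \<lambda>c. if c \<in> set cs
      then (rmem s c)(imem s 7 0 := 1 - rmem s c (imem s 7 0)) else rmem s c\<rparr>)"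
  shows "achieves (flip_coords cs q) (length cs + t) Q s"
  using assms
proof (induction cs arbitrary: s)
  case (Cons c cs)
  have *: "flip_coords (c # cs) q =
      Seq (RPut c (ivar 7) (RSub (RConst 1) (RGet c (ivar 7)))) (flip_coords cs q)"
    by (simp add: flip_coords_def)
  show ?case
    unfolding *
  proof (rule achieves_Seq[where t = 1 and u = "length cs + t"], rule achieves_RPut)
    let ?s = "s\<lparr>rmem := (rmem s)(c := (rmem s c)(ival (ivar 7) s :=
      rval (RSub (RConst 1) (RGet c (ivar 7))) s))\<rparr>"
    have "(\<lambda>c'. if c' \<in> set cs then (rmem ?s c')(imem ?s 7 0 := 1 - rmem ?s c' (imem ?s 7 0)) else rmem ?s c')
      = (\<lambda>c'. if c' \<in> set (c # cs) then (rmem s c')(imem s 7 0 := 1 - rmem s c' (imem s 7 0)) else rmem s c')"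
      using Cons.prems(1) by auto
    then show "achieves (flip_coords cs q) (length cs + t) Q ?s"
      using Cons.prems by (intro Cons.IH) auto
  qed simp_all
qed (simp add: flip_coords_def)

text \<open>\<open>y a\<close> is the current image of point number \<open>a\<close> under the Peano dynamics, \<open>g a\<close> its index so far;
  \<open>im\<close> frames the other integer arrays.\<close>

definition points_at ::
  "nat \<Rightarrow> nat \<Rightarrow> (nat \<Rightarrow> nat \<Rightarrow> real) \<Rightarrow> (nat \<Rightarrow> int) \<Rightarrow> (nat \<Rightarrow> int \<Rightarrow> int) \<Rightarrow> memory \<Rightarrow> bool" where
  "points_at k n y g im s \<longleftrightarrow>
     (\<forall>a<n. imem s 3 (int a) = g a \<and> (\<forall>c<k. rmem s c (int a) = y a c)) \<and>
     (\<forall>b. b \<noteq> 3 \<longrightarrow> imem s b = im b)"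

lemma achieves_advance_prog:
  assumes pts: "points_at k n y g im s" and i: "im 7 0 = int i" "i < n" and c: "c < k"
  shows "achieves (advance_prog k c) (k + 4)
    (points_at k n (y(i := advance c (y i))) (g(i := 3 * g i + digit (y i c))) im) s"
proof -
  let ?cs = "filter (\<lambda>c'. c' \<noteq> c) [0..<k]"
  have len: "length ?cs \<le> k"
    using length_filter_le[of "\<lambda>c'. c' \<noteq> c" "[0..<k]"] by simp
  have i': "imem s 7 0 = int i" using pts i by (auto simp: points_at_def)
  have at: "rmem s c' (int i) = y i c'" if "c' < k" for c'
    using pts i that by (auto simp: points_at_def)
  have g: "imem s 3 (int i) = g i" using pts i by (auto simp: points_at_def)
  have others: "imem s 3 (int a) = g a" "c' < k \<Longrightarrow> rmem s c' (int a) = y a c'" if "a < n" for a c'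
    using pts that by (auto simp: points_at_def)
  have fr: "b \<noteq> 3 \<Longrightarrow> imem s b = im b" for b using pts by (auto simp: points_at_def)
  show ?thesis
    unfolding advance_prog_def Let_def
  proof (rule achieves_If[where t = "k + 3"])
    assume "bval (RLess (RMul (RConst 3) (RGet c (ivar 7))) (RConst 1)) s"
    then have "digit (y i c) = 0" using at[OF c] by (simp add: i' digit_def)
    then show "achieves (Seq (RPut c (ivar 7) (RMul (RConst 3) (RGet c (ivar 7))))
        (IPut 3 (ivar 7) (IAdd (times3 (IGet 3 (ivar 7))) (IConst 0)))) (k + 3)
        (points_at k n (y(i := advance c (y i))) (g(i := 3 * g i + digit (y i c))) im) s"
      by (intro achieves_Seq[where t = 1 and u = 1] achieves_RPut achieves_IPut)
         (auto simp: points_at_def times3_def advance_def i' at[OF c] c g others fr i)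
  next
    assume 1: "\<not> bval (RLess (RMul (RConst 3) (RGet c (ivar 7))) (RConst 1)) s"
    show "achieves (If (RLess (RMul (RConst 3) (RGet c (ivar 7))) (RConst 2))
        (Seq (RPut c (ivar 7) (RSub (RMul (RConst 3) (RGet c (ivar 7))) (RConst 1)))
          (flip_coords ?cs (IPut 3 (ivar 7) (IAdd (times3 (IGet 3 (ivar 7))) (IConst 1)))))
        (Seq (RPut c (ivar 7) (RSub (RMul (RConst 3) (RGet c (ivar 7))) (RConst 2)))
          (IPut 3 (ivar 7) (IAdd (times3 (IGet 3 (ivar 7))) (IConst 2))))) (k + 3)
        (points_at k n (y(i := advance c (y i))) (g(i := 3 * g i + digit (y i c))) im) s"
    proof (rule achieves_If[where t = "k + 2"])
      assume "bval (RLess (RMul (RConst 3) (RGet c (ivar 7))) (RConst 2)) s"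
      with 1 have d: "digit (y i c) = 1" using at[OF c] by (simp add: i' digit_def)
      show "achieves (Seq (RPut c (ivar 7) (RSub (RMul (RConst 3) (RGet c (ivar 7))) (RConst 1)))
          (flip_coords ?cs (IPut 3 (ivar 7) (IAdd (times3 (IGet 3 (ivar 7))) (IConst 1))))) (k + 2)
          (points_at k n (y(i := advance c (y i))) (g(i := 3 * g i + digit (y i c))) im) s"
        by (rule achieves_Seq[where t = 1 and u = "length ?cs + 1"], rule achieves_RPut,
            rule achieves_flip_coords, simp, rule achieves_IPut)
           (use len in \<open>auto simp: points_at_def times3_def advance_def i' at c g others fr i d\<close>)
    next
      assume "\<not> bval (RLess (RMul (RConst 3) (RGet c (ivar 7))) (RConst 2)) s"
      then have "digit (y i c) = 2" using at[OF c] by (simp add: i' digit_def)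
      then show "achieves (Seq (RPut c (ivar 7) (RSub (RMul (RConst 3) (RGet c (ivar 7))) (RConst 2)))
          (IPut 3 (ivar 7) (IAdd (times3 (IGet 3 (ivar 7))) (IConst 2)))) (k + 2)
          (points_at k n (y(i := advance c (y i))) (g(i := 3 * g i + digit (y i c))) im) s"
        by (intro achieves_Seq[where t = 1 and u = 1] achieves_RPut achieves_IPut)
           (auto simp: points_at_def times3_def advance_def i' at[OF c] c g others fr i)
    qed simp
  qed simp
qed

lemma achieves_advance_progs:
  assumes "points_at k n y g im s" "im 7 0 = int i" "i < n" "set cs \<subseteq> {..<k}"
    and "\<And>s'. points_at k n (y(i := fold advance cs (y i)))
           (g(i := g i * 3 ^ length cs + peano cs (y i))) im s' \<Longrightarrow> achieves q t Q s'"
  shows "achieves (foldr Seq (map (advance_prog k) cs) q) (length cs * (k + 4) + t) Q s"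
  using assms
proof (induction cs arbitrary: y g s)
  case (Cons c cs)
  let ?y = "y(i := advance c (y i))" and ?g = "g(i := 3 * g i + digit (y i c))"
  have *: "achieves (advance_prog k c) (k + 4) (points_at k n ?y ?g im) s"
    using Cons.prems by (intro achieves_advance_prog) auto
  have "achieves (foldr Seq (map (advance_prog k) cs) q) (length cs * (k + 4) + t) Q s'"
    if "points_at k n ?y ?g im s'" for s'
  proof (rule Cons.IH[OF that Cons.prems(2,3)])
    show "set cs \<subseteq> {..<k}" using Cons.prems(4) by simp
    show "achieves q t Q s''" if "points_at k n (?y(i := fold advance cs (?y i)))
        (?g(i := ?g i * 3 ^ length cs + peano cs (?y i))) im s''" for s''
    proof -
      have "?y(i := fold advance cs (?y i)) = y(i := fold advance (c # cs) (y i))"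
        "?g(i := ?g i * 3 ^ length cs + peano cs (?y i)) = g(i := g i * 3 ^ length (c # cs) + peano (c # cs) (y i))"
        by (simp_all add: fun_eq_iff algebra_simps)
      with that show ?thesis by (metis Cons.prems(5))
    qed
  qed
  then show ?case
    using achieves_mono[OF *]
    by (simp, intro achieves_Seq[where t = "k + 4" and u = "length cs * (k + 4) + t"]) auto
qed simp

lemma achieves_sweep_prog:
  assumes "points_at k n y g im s" "im 7 0 = int i" "i < n"
  shows "achieves (sweep_prog k) (k * (k + 4) + 1)
    (points_at k n (y(i := fold advance [0..<k] (y i))) (g(i := g i * 3 ^ k + peano [0..<k] (y i)))
      (im(7 := (im 7)(0 := int (Suc i))))) s"
proof -
  have "achieves (sweep_prog k) (length [0..<k] * (k + 4) + 1)
    (points_at k n (y(i := fold advance [0..<k] (y i))) (g(i := g i * 3 ^ k + peano [0..<k] (y i)))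
      (im(7 := (im 7)(0 := int (Suc i))))) s"
    unfolding sweep_prog_def
  proof (rule achieves_advance_progs[OF assms])
    fix s'
    assume s': "points_at k n (y(i := fold advance [0..<k] (y i)))
      (g(i := g i * 3 ^ length [0..<k] + peano [0..<k] (y i))) im s'"
    then have "imem s' 7 = im 7" by (simp add: points_at_def)
    with s' assms(2) show "achieves (iset 7 (IAdd (ivar 7) (IConst 1))) 1
        (points_at k n (y(i := fold advance [0..<k] (y i))) (g(i := g i * 3 ^ k + peano [0..<k] (y i)))
      (im(7 := (im 7)(0 := int (Suc i))))) s'"
      by (intro achieves_IPut) (auto simp: points_at_def add.commute)
  qed auto
  then show ?thesis by simp
qed

lemma achieves_sweep_loop:
  assumes "points_at k n y g im s" "im 7 0 = 0" "im 0 0 = int n"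
  shows "achieves (While (ILess (ivar 7) (ivar 0)) (sweep_prog k)) (n * (k * (k + 4) + 2) + 1)
    (points_at k n (\<lambda>a. fold advance [0..<k] (y a)) (\<lambda>a. g a * 3 ^ k + peano [0..<k] (y a))
      (im(7 := (im 7)(0 := int n)))) s"
proof -
  \<comment> \<open>Points below \<open>i\<close> are one sweep ahead of the others.\<close>
  define Inv where "Inv = (\<lambda>i. points_at k n
      (\<lambda>a. if a < i then fold advance [0..<k] (y a) else y a)
      (\<lambda>a. if a < i then g a * 3 ^ k + peano [0..<k] (y a) else g a)
      (im(7 := (im 7)(0 := int i))))"
  have guard: "bval (ILess (ivar 7) (ivar 0)) s \<longleftrightarrow> i < n" if "Inv i s" for i s
    using that assms(3) by (auto simp: Inv_def points_at_def)
  have "achieves (While (ILess (ivar 7) (ivar 0)) (sweep_prog k)) (n * (k * (k + 4) + 2) + 1) (Inv n) s"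
  proof (rule achieves_While[where t = "k * (k + 4) + 1"])
    fix i s assume i: "i < n" and Inv: "Inv i s"
    have "achieves (sweep_prog k) (k * (k + 4) + 1) (Inv (Suc i)) s"
      by (rule achieves_mono[OF achieves_sweep_prog[OF Inv[unfolded Inv_def], of i]])
         (use i in \<open>auto simp: Inv_def points_at_def less_Suc_eq\<close>)
    with i guard[OF Inv] show "bval (ILess (ivar 7) (ivar 0)) s \<and>
        achieves (sweep_prog k) (k * (k + 4) + 1) (Inv (Suc i)) s" by blast
  next
    have "im(7 := (im 7)(0 := 0)) = im" using assms(2) by (auto simp: fun_eq_iff)
    with assms(1) show "Inv 0 s" by (simp add: Inv_def)
  qed (use guard in auto)
  then show ?thesis
    by (rule achieves_mono) (auto simp: Inv_def points_at_def)
qed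

lemma achieves_triple:
  assumes "\<And>s'. s' = s\<lparr>imem := (imem s)(6 := (imem s 6)(0 := 3 ^ j * imem s 6 0))\<rparr> \<Longrightarrow> achieves q t Q s'"
  shows "achieves (foldr Seq (replicate j (iset 6 (times3 (ivar 6)))) q) (j + t) Q s"
  using assms
proof (induction j arbitrary: s)
  case (Suc j)
  have "achieves (Seq (iset 6 (times3 (ivar 6))) (foldr Seq (replicate j (iset 6 (times3 (ivar 6)))) q))
      (Suc j + t) Q s"
  proof (rule achieves_Seq[where t = 1 and u = "j + t"])
    show "achieves (iset 6 (times3 (ivar 6))) 1
        (achieves (foldr Seq (replicate j (iset 6 (times3 (ivar 6)))) q) (j + t) Q) s"
    proof (rule achieves_IPut, rule Suc.IH, rule Suc.prems)
    qed (auto simp: times3_def fun_eq_iff algebra_simps)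
  qed simp
  then show ?case by simp
qed simp

lemma achieves_refine_prog:
  assumes pts: "points_at k n y g im s" and n: "im 0 0 = int n"
  shows "achieves (refine_prog k) (n * (k * (k + 4) + 2) + k + 2)
    (points_at k n (\<lambda>a. fold advance [0..<k] (y a)) (\<lambda>a. g a * 3 ^ k + peano [0..<k] (y a))
      (im(6 := (im 6)(0 := 3 ^ k * im 6 0), 7 := (im 7)(0 := int n)))) s" (is "achieves _ _ ?Q s")
proof -
  have "achieves (refine_prog k) (k + (n * (k * (k + 4) + 2) + 2)) ?Q s"
    unfolding refine_prog_def
  proof (rule achieves_triple)
    fix s' assume s': "s' = s\<lparr>imem := (imem s)(6 := (imem s 6)(0 := 3 ^ k * imem s 6 0))\<rparr>"
    let ?im = "im(6 := (im 6)(0 := 3 ^ k * im 6 0), 7 := (im 7)(0 := 0))"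
    let ?s = "s'\<lparr>imem := (imem s')(7 := (imem s' 7)(0 := 0))\<rparr>"
    have "achieves (While (ILess (ivar 7) (ivar 0)) (sweep_prog k)) (n * (k * (k + 4) + 2) + 1)
      (points_at k n (\<lambda>a. fold advance [0..<k] (y a)) (\<lambda>a. g a * 3 ^ k + peano [0..<k] (y a))
      (?im(7 := (?im 7)(0 := int n)))) ?s"
      by (rule achieves_sweep_loop) (use pts n in \<open>auto simp: s' points_at_def\<close>)
    then have "achieves (While (ILess (ivar 7) (ivar 0)) (sweep_prog k)) (n * (k * (k + 4) + 2) + 1) ?Q ?s"
      by simp
    then show "achieves (Seq (iset 7 (IConst 0)) (While (ILess (ivar 7) (ivar 0)) (sweep_prog k)))
        (n * (k * (k + 4) + 2) + 2) ?Q s'"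
      by (intro achieves_Seq[where t = 1 and u = "n * (k * (k + 4) + 2) + 1"] achieves_IPut) auto
  qed
  then show ?thesis by (rule achieves_mono) auto
qed

lemma achieves_refine_loop:
  assumes pts: "points_at k n x (\<lambda>_. 0) im s" and n: "im 0 0 = int n" and N: "im 6 0 = 1"
    and m: "int n \<le> 3 ^ (k * m)" "\<And>l. l < m \<Longrightarrow> 3 ^ (k * l) < int n"
  shows "achieves (While (ILess (ivar 6) (ivar 0)) (refine_prog k))
    (m * (n * (k * (k + 4) + 2) + k + 3) + 1)
    (\<lambda>s. (\<forall>a<n. imem s 3 (int a) = peano (sweep k m) (x a)) \<and> imem s 6 0 = 3 ^ (k * m) \<and>
         (\<forall>b. b \<notin> {3, 6, 7} \<longrightarrow> imem s b = im b)) s"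
proof -
  \<comment> \<open>Counter 7 ends each round at \<open>n\<close> but may differ before the first,
    hence the existential.\<close>
  define Inv where "Inv = (\<lambda>l s. \<exists>i. points_at k n (\<lambda>a. fold advance (sweep k l) (x a))
      (\<lambda>a. peano (sweep k l) (x a)) (im(6 := (im 6)(0 := 3 ^ (k * l)), 7 := (im 7)(0 := i))) s)"
  have sweep_Suc: "sweep k (Suc l) = sweep k l @ [0..<k]" for l
    using sweep_add[of k l 1] by (simp add: sweep_def)
  have guard: "bval (ILess (ivar 6) (ivar 0)) s \<longleftrightarrow> 3 ^ (k * l) < int n" if "Inv l s" for l s
    using that n by (auto simp: Inv_def points_at_def)
  have "achieves (While (ILess (ivar 6) (ivar 0)) (refine_prog k))
    (m * (n * (k * (k + 4) + 2) + k + 3) + 1) (Inv m) s"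
  proof (rule achieves_While[where t = "n * (k * (k + 4) + 2) + k + 2"])
    fix l s assume l: "l < m" and Inv: "Inv l s"
    then obtain i where "points_at k n (\<lambda>a. fold advance (sweep k l) (x a))
      (\<lambda>a. peano (sweep k l) (x a)) (im(6 := (im 6)(0 := 3 ^ (k * l)), 7 := (im 7)(0 := i))) s"
      by (auto simp: Inv_def)
    from achieves_refine_prog[OF this]
    have "achieves (refine_prog k) (n * (k * (k + 4) + 2) + k + 2) (Inv (Suc l)) s"
      by (rule achieves_mono)
         (auto simp: n Inv_def sweep_Suc peano_append power_add mult.commute fun_upd_twist intro!: exI[of _ "int n"])
    with m(2)[OF l] guard[OF Inv] show "bval (ILess (ivar 6) (ivar 0)) s \<and>
        achieves (refine_prog k) (n * (k * (k + 4) + 2) + k + 2) (Inv (Suc l)) s" by blast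
  next
    have "im(6 := (im 6)(0 := 1), 7 := (im 7)(0 := im 7 0)) = im" using N by (auto simp: fun_eq_iff)
    with pts show "Inv 0 s" by (auto simp: Inv_def sweep_def intro!: exI[of _ "im 7 0"])
  qed (use guard m in \<open>auto simp: algebra_simps\<close>)
  then show ?thesis
    by (rule achieves_mono) (auto simp: Inv_def points_at_def)
qed

section \<open>Recording edges and pairing within cells\<close>

definition recorded :: "(nat \<times> nat) list \<Rightarrow> (nat \<Rightarrow> int \<Rightarrow> int) \<Rightarrow> bool" where
  "recorded P im \<longleftrightarrow> im 10 0 = int (length P) \<and>
     (\<forall>l<length P. im 1 (int l) = int (fst (P ! l)) \<and> im 2 (int l) = int (snd (P ! l)))"

text \<open>Both expressions are evaluated again after the output arrays and the edge counter have
  changed, so \<open>exprs\<close> demands independence of these. The two outcomes stay open for the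
  invariants of the two uses.\<close>

lemma achieves_toggle:
  assumes rec: "recorded P (imem s)" and d: "d \<notin> {1, 2, 10}"
    and exprs: "\<And>s'. (\<And>e. e \<notin> {1, 2, 10} \<Longrightarrow> imem s' e = imem s e) \<Longrightarrow> ival i s' = c \<and> ival x s' = int a + 1"
    and slot: "imem s d c = 0 \<or> (\<exists>b. imem s d c = int b + 1)"
    and empty: "\<And>s'. imem s d c = 0 \<Longrightarrow> recorded P (imem s') \<Longrightarrow> imem s' d = (imem s d)(c := int a + 1) \<Longrightarrow>
      (\<And>e. e \<notin> {1, 2, 10, d} \<Longrightarrow> imem s' e = imem s e) \<Longrightarrow> Q s'"
    and full: "\<And>s' b. imem s d c = int b + 1 \<Longrightarrow> recorded (P @ [(b, a)]) (imem s') \<Longrightarrow>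
      imem s' d = (imem s d)(c := 0) \<Longrightarrow> (\<And>e. e \<notin> {1, 2, 10, d} \<Longrightarrow> imem s' e = imem s e) \<Longrightarrow> Q s'"
  shows "achieves (toggle d i x) 5 Q s"
proof -
  have d': "d \<noteq> 1" "d \<noteq> 2" "d \<noteq> 10" using d by auto
  have s: "ival i s = c" "ival x s = int a + 1" using exprs[of s] by auto
  show ?thesis
    unfolding toggle_def
  proof (rule achieves_If[where t = 4])
    assume "bval (ILess (IConst 0) (IGet d i)) s"
    then obtain b where b: "imem s d c = int b + 1" using slot s by auto
    define s1 where "s1 = s\<lparr>imem := (imem s)(1 := (imem s 1)(ival (ivar 10) s := ival (ISub (IGet d i) (IConst 1)) s))\<rparr>"
    define s2 where "s2 = s1\<lparr>imem := (imem s1)(2 := (imem s1 2)(ival (ivar 10) s1 := ival (ISub x (IConst 1)) s1))\<rparr>"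
    define s3 where "s3 = s2\<lparr>imem := (imem s2)(10 := (imem s2 10)(ival (IConst 0) s2 := ival (IAdd (ivar 10) (IConst 1)) s2))\<rparr>"
    define s4 where "s4 = s3\<lparr>imem := (imem s3)(d := (imem s3 d)(ival i s3 := ival (IConst 0) s3))\<rparr>"
    have im1: "imem s1 = (imem s)(1 := (imem s 1)(imem s 10 0 := int b))"
      by (simp add: s1_def s b)
    have 1: "ival x s1 = int a + 1" by (rule exprs[THEN conjunct2]) (auto simp: im1)
    have im2: "imem s2 = (imem s1)(2 := (imem s 2)(imem s 10 0 := int a))"
      by (simp add: s2_def 1) (simp add: im1)
    have im3: "imem s3 = (imem s2)(10 := (imem s 10)(0 := imem s 10 0 + 1))"
      by (simp add: s3_def) (simp add: im2 im1)
    have 3: "ival i s3 = c" by (rule exprs[THEN conjunct1]) (auto simp: im1 im2 im3)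
    have im4: "imem s4 = (imem s3)(d := (imem s d)(c := 0))"
      using d' by (simp add: s4_def 3) (simp add: im3 im2 im1)
    note im = im1 im2 im3 im4
    have Q: "Q s4"
    proof (rule full[OF b])
      show "recorded (P @ [(b, a)]) (imem s4)"
        using rec d' by (auto simp: recorded_def im nth_append less_Suc_eq)
      show "imem s4 d = (imem s d)(c := 0)"
        using d' by (simp add: im)
      show "imem s4 e = imem s e" if "e \<notin> {1, 2, 10, d}" for e
        using that by (simp add: im)
    qed
    have "achieves (IPut d i (IConst 0)) 1 Q s3"
      using Q unfolding s4_def by (rule achieves_IPut) simp
    then have "achieves (Seq (iset 10 (IAdd (ivar 10) (IConst 1))) (IPut d i (IConst 0))) 2 Q s2"
      unfolding s3_def by - (rule achieves_Seq[where t = 1 and u = 1], rule achieves_IPut, simp_all)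
    then have "achieves (Seq (IPut 2 (ivar 10) (ISub x (IConst 1)))
        (Seq (iset 10 (IAdd (ivar 10) (IConst 1))) (IPut d i (IConst 0)))) 3 Q s1"
      unfolding s2_def by - (rule achieves_Seq[where t = 1 and u = 2], rule achieves_IPut, simp_all)
    then show "achieves (Seq (IPut 1 (ivar 10) (ISub (IGet d i) (IConst 1)))
        (Seq (IPut 2 (ivar 10) (ISub x (IConst 1)))
        (Seq (iset 10 (IAdd (ivar 10) (IConst 1))) (IPut d i (IConst 0))))) 4 Q s"
      unfolding s1_def by - (rule achieves_Seq[where t = 1 and u = 3], rule achieves_IPut, simp_all)
  next
    assume "\<not> bval (ILess (IConst 0) (IGet d i)) s"
    then have e: "imem s d c = 0" using slot s by auto
    show "achieves (IPut d i x) 4 Q s"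
      by (rule achieves_IPut, rule empty[OF e]) (use rec d' in \<open>auto simp: recorded_def s\<close>)
  qed simp
qed

text \<open>Being a list, it expresses by distinctness alone that edges are disjoint and have two
  different endpoints.\<close>

definition ends :: "(nat \<times> nat) list \<Rightarrow> nat list" where
  "ends P = map fst P @ map snd P"

lemma set_ends_append [simp]: "set (ends (P @ [(b, a)])) = insert a (insert b (set (ends P)))"
  by (auto simp: ends_def)

lemma distinct_ends_append [simp]:
  "distinct (ends (P @ [(b, a)])) \<longleftrightarrow> distinct (ends P) \<and> a \<notin> set (ends P) \<and> b \<notin> set (ends P) \<and> a \<noteq> b"
  by (auto simp: ends_def)

text \<open>Buckets hold point numbers plus one, so that the initial value \<open>0\<close> means empty.\<close>

definition bucketed :: "(nat \<Rightarrow> int) \<Rightarrow> (nat \<Rightarrow> int \<Rightarrow> int) \<Rightarrow> nat \<Rightarrow> memory \<Rightarrow> bool" where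
  "bucketed g im i s \<longleftrightarrow> (\<exists>P. recorded P (imem s) \<and> distinct (ends P) \<and> set (ends P) \<subseteq> {..<i} \<and>
     (\<forall>(a, b)\<in>set P. g a = g b) \<and>
     (\<forall>c. imem s 4 c = 0 \<or> (\<exists>a<i. a \<notin> set (ends P) \<and> g a = c \<and> imem s 4 c = int a + 1)) \<and>
     (\<forall>a<i. a \<notin> set (ends P) \<longrightarrow> imem s 4 (g a) = int a + 1) \<and>
     imem s 7 0 = int i \<and> (\<forall>e. e \<notin> {1, 2, 4, 7, 10} \<longrightarrow> imem s e = im e))"

lemma achieves_bucket_prog:
  assumes "bucketed g im i s" and g: "im 3 (int i) = g i"
  shows "achieves bucket_prog 6 (bucketed g im (Suc i)) s"
proof -
  from assms(1) obtain P where P: "recorded P (imem s)" "distinct (ends P)" "set (ends P) \<subseteq> {..<i}"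
    "\<forall>(a, b)\<in>set P. g a = g b"
    and head: "\<And>c. imem s 4 c = 0 \<or> (\<exists>a<i. a \<notin> set (ends P) \<and> g a = c \<and> imem s 4 c = int a + 1)"
    and un: "\<And>a. a < i \<Longrightarrow> a \<notin> set (ends P) \<Longrightarrow> imem s 4 (g a) = int a + 1"
    and i: "imem s 7 0 = int i" and fr: "\<And>e. e \<notin> {1, 2, 4, 7, 10} \<Longrightarrow> imem s e = im e"
    unfolding bucketed_def by blast
  have i_notin: "i \<notin> set (ends P)" using P(3) by auto
  show ?thesis
    unfolding bucket_prog_def
  proof (rule achieves_Seq[where t = 5 and u = 1], rule achieves_toggle[OF P(1)])
    show "ival (IGet 3 (ivar 7)) s' = g i \<and> ival (IAdd (ivar 7) (IConst 1)) s' = int i + 1"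
      if "\<And>e. e \<notin> {1, 2, 10} \<Longrightarrow> imem s' e = imem s e" for s'
      using that[of 7] that[of 3] fr[of 3] i g by simp
    show "imem s 4 (g i) = 0 \<or> (\<exists>b. imem s 4 (g i) = int b + 1)" using head by blast
  next
    fix s' :: memory assume *: "imem s 4 (g i) = 0" "recorded P (imem s')" "imem s' 4 = (imem s 4)(g i := int i + 1)"
      "\<And>e. e \<notin> {1, 2, 10, 4} \<Longrightarrow> imem s' e = imem s e"
    let ?s = "s'\<lparr>imem := (imem s')(7 := (imem s' 7)(0 := int (Suc i)))\<rparr>"
    have "bucketed g im (Suc i) ?s"
      unfolding bucketed_def
    proof (intro exI[of _ P] conjI)
      show "recorded P (imem ?s)" using *(2) by (simp add: recorded_def)
      show "set (ends P) \<subseteq> {..<Suc i}" using P(3) by auto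
      show "\<forall>c. imem ?s 4 c = 0 \<or> (\<exists>a<Suc i. a \<notin> set (ends P) \<and> g a = c \<and> imem ?s 4 c = int a + 1)"
      proof
        fix c
        consider "c = g i" | "c \<noteq> g i" "imem s 4 c = 0"
          | a where "c \<noteq> g i" "a < i" "a \<notin> set (ends P)" "g a = c" "imem s 4 c = int a + 1"
          using head[of c] by blast
        then show "imem ?s 4 c = 0 \<or> (\<exists>a<Suc i. a \<notin> set (ends P) \<and> g a = c \<and> imem ?s 4 c = int a + 1)"
        proof cases
          case 1
          then show ?thesis using i_notin by (intro disjI2 exI[of _ i]) (auto simp: *(3))
        next
          case (3 a)
          then show ?thesis by (intro disjI2 exI[of _ a]) (auto simp: *(3))
        qed (auto simp: *(3))
      qed
      show "\<forall>a<Suc i. a \<notin> set (ends P) \<longrightarrow> imem ?s 4 (g a) = int a + 1"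
      proof (intro allI impI)
        fix a assume a: "a < Suc i" "a \<notin> set (ends P)"
        show "imem ?s 4 (g a) = int a + 1"
        proof (cases "a = i")
          case False
          then have "imem s 4 (g a) = int a + 1" using a un by simp
          with *(1) show ?thesis by (auto simp: *(3))
        qed (simp add: *(3))
      qed
    qed (use P fr *(4) in auto)
    moreover have "imem s' 7 0 = int i" using *(4)[of 7] i by simp
    ultimately show "achieves (iset 7 (IAdd (ivar 7) (IConst 1))) 1 (bucketed g im (Suc i)) s'"
      by (intro achieves_IPut) (auto simp: add.commute)
  next
    fix s' :: memory and b assume *: "imem s 4 (g i) = int b + 1" "recorded (P @ [(b, i)]) (imem s')"
      "imem s' 4 = (imem s 4)(g i := 0)" "\<And>e. e \<notin> {1, 2, 10, 4} \<Longrightarrow> imem s' e = imem s e"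
    \<comment> \<open>The occupant lies in the cell of \<open>i\<close>, so the new pair has gap
      zero.\<close>
    have b: "b < i" "b \<notin> set (ends P)" "g b = g i" using head[of "g i"] *(1) by auto
    let ?s = "s'\<lparr>imem := (imem s')(7 := (imem s' 7)(0 := int (Suc i)))\<rparr>"
    have "bucketed g im (Suc i) ?s"
      unfolding bucketed_def
    proof (intro exI[of _ "P @ [(b, i)]"] conjI)
      show "recorded (P @ [(b, i)]) (imem ?s)" using *(2) by (simp add: recorded_def)
      show "set (ends (P @ [(b, i)])) \<subseteq> {..<Suc i}" using P(3) b by auto
      show "distinct (ends (P @ [(b, i)]))" using P(2) b i_notin by auto
      show "\<forall>(a, b)\<in>set (P @ [(b, i)]). g a = g b" using P(4) b by auto
      show "\<forall>c. imem ?s 4 c = 0 \<or> (\<exists>a<Suc i. a \<notin> set (ends (P @ [(b, i)])) \<and> g a = c \<and> imem ?s 4 c = int a + 1)"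
      proof
        fix c
        consider "c = g i" | "c \<noteq> g i" "imem s 4 c = 0"
          | a where "c \<noteq> g i" "a < i" "a \<notin> set (ends P)" "g a = c" "imem s 4 c = int a + 1"
          using head[of c] by blast
        then show "imem ?s 4 c = 0 \<or> (\<exists>a<Suc i. a \<notin> set (ends (P @ [(b, i)])) \<and> g a = c \<and> imem ?s 4 c = int a + 1)"
        proof cases
          case (3 a)
          then show ?thesis using b by (intro disjI2 exI[of _ a]) (auto simp: *(3))
        qed (auto simp: *(3))
      qed
      show "\<forall>a<Suc i. a \<notin> set (ends (P @ [(b, i)])) \<longrightarrow> imem ?s 4 (g a) = int a + 1"
      proof (intro allI impI)
        fix a assume a: "a < Suc i" "a \<notin> set (ends (P @ [(b, i)]))"
        then have a': "a < i" "a \<notin> set (ends P)" "a \<noteq> b" by auto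
        \<comment> \<open>A bucket names a single point, so unmatched points other than
          \<open>b\<close> lie in other cells and clearing this bucket loses none.\<close>
        from un[OF a'(1,2)] *(1) a'(3) have "g a \<noteq> g i" by auto
        with un[OF a'(1,2)] show "imem ?s 4 (g a) = int a + 1" by (simp add: *(3))
      qed
    qed (use fr *(4) in auto)
    moreover have "imem s' 7 0 = int i" using *(4)[of 7] i by simp
    ultimately show "achieves (iset 7 (IAdd (ivar 7) (IConst 1))) 1 (bucketed g im (Suc i)) s'"
      by (intro achieves_IPut) (auto simp: add.commute)
  qed simp_all
qed

lemma achieves_bucket_loop:
  assumes "bucketed g im 0 s" and "\<And>a. a < n \<Longrightarrow> im 3 (int a) = g a" and n: "im 0 0 = int n"
  shows "achieves (While (ILess (ivar 7) (ivar 0))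
           bucket_prog) (n * 7 + 1) (bucketed g im n) s"
proof (rule achieves_While[where t = 6])
  have guard: "bval (ILess (ivar 7) (ivar 0)) s \<longleftrightarrow> i < n" if "bucketed g im i s" for i s
    using that n by (auto simp: bucketed_def)
  show "bval (ILess (ivar 7) (ivar 0)) s \<and> achieves bucket_prog 6 (bucketed g im (Suc i)) s" if "i < n" "bucketed g im i s" for i s
    using that guard assms(2) achieves_bucket_prog by blast
  show "\<not> bval (ILess (ivar 7) (ivar 0)) s" if "bucketed g im n s" for s
    using guard[OF that] by simp
qed (use assms in auto)

section \<open>Pairing leftovers along the curve\<close>

definition gap_sum :: "(nat \<Rightarrow> int) \<Rightarrow> (nat \<times> nat) list \<Rightarrow> int" where
  "gap_sum g P = (\<Sum>(a, b)\<leftarrow>P. \<bar>g a - g b\<bar>)"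

text \<open>One point \<open>p\<close> may be waiting for a partner; the gaps are disjoint intervals below \<open>b\<close>, or below
  \<open>g p\<close>.\<close>

definition emptied :: "nat \<Rightarrow> (nat \<Rightarrow> int) \<Rightarrow> int \<Rightarrow> (nat \<times> nat) list \<Rightarrow> int \<Rightarrow> (int \<Rightarrow> int) \<Rightarrow> bool" where
  "emptied n g b P pending head \<longleftrightarrow> distinct (ends P) \<and> set (ends P) \<subseteq> {..<n} \<and>
     (pending = 0 \<and> gap_sum g P \<le> b \<and> (\<forall>a<n. a \<notin> set (ends P) \<longrightarrow> b \<le> g a) \<or>
      (\<exists>p<n. pending = int p + 1 \<and> p \<notin> set (ends P) \<and> g p < b \<and> gap_sum g P \<le> g p \<and>
             (\<forall>a<n. a \<notin> set (ends P) \<longrightarrow> a = p \<or> b \<le> g a))) \<and>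
     (\<forall>c\<ge>b. head c = 0 \<or> (\<exists>a<n. a \<notin> set (ends P) \<and> g a = c \<and> head c = int a + 1)) \<and>
     (\<forall>a<n. a \<notin> set (ends P) \<longrightarrow> b \<le> g a \<longrightarrow> head (g a) = int a + 1)"

text \<open>Buckets are read but not cleared in this phase, so the invariant trusts them only from
  \<open>b\<close> on. There, an empty bucket means that the cell has no unmatched point.\<close>

lemma emptied_skip:
  assumes "emptied n g b P pending head" "head b = 0"
  shows "emptied n g (b + 1) P pending head"
proof -
  have "g a \<noteq> b" if "a < n" "a \<notin> set (ends P)" for a
  proof
    assume "g a = b"
    then have "head b = int a + 1" using assms(1) that unfolding emptied_def by blast
    then show False using assms(2) by simp
  qed
  then have *: "b + 1 \<le> g a \<longleftrightarrow> b \<le> g a" if "a < n" "a \<notin> set (ends P)" for a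
    using that by fastforce
  from assms(1) have "pending = 0 \<and> gap_sum g P \<le> b + 1 \<and> (\<forall>a<n. a \<notin> set (ends P) \<longrightarrow> b + 1 \<le> g a) \<or>
      (\<exists>p<n. pending = int p + 1 \<and> p \<notin> set (ends P) \<and> g p < b + 1 \<and> gap_sum g P \<le> g p \<and>
             (\<forall>a<n. a \<notin> set (ends P) \<longrightarrow> a = p \<or> b + 1 \<le> g a))"
    unfolding emptied_def
    by (elim conjE disjE exE) (auto simp: * intro!: disjI2)
  moreover have "\<forall>c\<ge>b + 1. head c = 0 \<or> (\<exists>a<n. a \<notin> set (ends P) \<and> g a = c \<and> head c = int a + 1)"
    using assms(1) unfolding emptied_def by simp
  moreover have "\<forall>a<n. a \<notin> set (ends P) \<longrightarrow> b + 1 \<le> g a \<longrightarrow> head (g a) = int a + 1"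
    using assms(1) unfolding emptied_def by simp
  ultimately show ?thesis using assms(1) unfolding emptied_def by blast
qed

text \<open>All earlier gaps fit below \<open>b\<close>, which is the index of the point that starts
  to wait; the gap it will open overlaps none of them.\<close>

lemma emptied_store:
  assumes "emptied n g b P 0 head" "head b = int a + 1"
  shows "a < n \<and> emptied n g (b + 1) P (int a + 1) head"
proof -
  obtain a' where "a' < n" "a' \<notin> set (ends P)" "g a' = b" "head b = int a' + 1"
    using assms unfolding emptied_def by force
  then have a: "a < n" "a \<notin> set (ends P)" "g a = b" using assms(2) by auto
  have near: "a' = a \<or> b + 1 \<le> g a'" if a': "a' < n" "a' \<notin> set (ends P)" for a'
  proof (cases "g a' = b")
    case True
    then have "head b = int a' + 1" using assms(1) a' unfolding emptied_def by blast
    then show ?thesis using assms(2) by simp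
  next
    case False
    have "b \<le> g a'" using assms(1) a' unfolding emptied_def by auto
    with False show ?thesis by simp
  qed
  have gap: "gap_sum g P \<le> g a" using assms(1) a(3) unfolding emptied_def by auto
  have "emptied n g (b + 1) P (int a + 1) head"
    unfolding emptied_def
  proof (intro conjI disjI2 exI[of _ a])
    show "\<forall>c\<ge>b + 1. head c = 0 \<or> (\<exists>a<n. a \<notin> set (ends P) \<and> g a = c \<and> head c = int a + 1)"
      "\<forall>a<n. a \<notin> set (ends P) \<longrightarrow> b + 1 \<le> g a \<longrightarrow> head (g a) = int a + 1"
      "distinct (ends P)" "set (ends P) \<subseteq> {..<n}"
      using assms(1) unfolding emptied_def by simp_all
  qed (use a gap near in auto)
  with a show ?thesis by blast
qed

lemma emptied_match:
  assumes sw: "emptied n g b P (int p + 1) head" and hb: "head b = int a + 1"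
  shows "a < n \<and> emptied n g (b + 1) (P @ [(p, a)]) 0 head"
proof -
  have d: "distinct (ends P)" "set (ends P) \<subseteq> {..<n}" using sw unfolding emptied_def by auto
  obtain a' where "a' < n" "a' \<notin> set (ends P)" "g a' = b" "head b = int a' + 1"
    using assms unfolding emptied_def by force
  then have a: "a < n" "a \<notin> set (ends P)" "g a = b" using hb by auto
  have p: "p < n" "p \<notin> set (ends P)" "g p < b" "gap_sum g P \<le> g p"
    and un: "\<And>a. a < n \<Longrightarrow> a \<notin> set (ends P) \<Longrightarrow> a = p \<or> b \<le> g a"
    using sw unfolding emptied_def by auto
  have head: "\<And>c. b \<le> c \<Longrightarrow> head c = 0 \<or> (\<exists>a<n. a \<notin> set (ends P) \<and> g a = c \<and> head c = int a + 1)"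
    and headg: "\<And>a. a < n \<Longrightarrow> a \<notin> set (ends P) \<Longrightarrow> b \<le> g a \<Longrightarrow> head (g a) = int a + 1"
    using sw unfolding emptied_def by blast+
  have "emptied n g (b + 1) (P @ [(p, a)]) 0 head"
    unfolding emptied_def
  proof (intro conjI disjI1)
    \<comment> \<open>Earlier gaps sum to at most \<open>g p\<close>, and the new one is
      \<open>b - g p\<close>.\<close>
    show "gap_sum g (P @ [(p, a)]) \<le> b + 1"
      using p a by (simp add: gap_sum_def)
    show "\<forall>a'<n. a' \<notin> set (ends (P @ [(p, a)])) \<longrightarrow> b + 1 \<le> g a'"
    proof (intro allI impI)
      fix a' assume "a' < n" "a' \<notin> set (ends (P @ [(p, a)]))"
      then have a': "a' < n" "a' \<notin> set (ends P)" "a' \<noteq> a" "a' \<noteq> p" by auto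
      with un have "b \<le> g a'" by blast
      moreover have "g a' \<noteq> b" using headg[OF a'(1,2)] hb a'(3) by auto
      ultimately show "b + 1 \<le> g a'" by simp
    qed
    show "\<forall>c\<ge>b + 1. head c = 0 \<or> (\<exists>a'<n. a' \<notin> set (ends (P @ [(p, a)])) \<and> g a' = c \<and> head c = int a' + 1)"
    proof (intro allI impI)
      fix c assume c: "b + 1 \<le> c"
      consider "head c = 0" | a' where "a' < n" "a' \<notin> set (ends P)" "g a' = c" "head c = int a' + 1"
        using head[of c] c by auto
      then show "head c = 0 \<or> (\<exists>a'<n. a' \<notin> set (ends (P @ [(p, a)])) \<and> g a' = c \<and> head c = int a' + 1)"
      proof cases
        case (2 a')
        then show ?thesis using c a p by (intro disjI2 exI[of _ a']) auto
      qed simp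
    qed
    show "\<forall>a'<n. a' \<notin> set (ends (P @ [(p, a)])) \<longrightarrow> b + 1 \<le> g a' \<longrightarrow> head (g a') = int a' + 1"
      using headg by auto
  qed (use d a p in auto)
  with a show ?thesis by blast
qed

definition emptying :: "nat \<Rightarrow> (nat \<Rightarrow> int) \<Rightarrow> int \<Rightarrow> nat \<Rightarrow> memory \<Rightarrow> bool" where
  "emptying n g N b s \<longleftrightarrow> (\<exists>P. recorded P (imem s) \<and> emptied n g (int b) P (imem s 9 0) (imem s 4) \<and>
     imem s 6 0 = N \<and> imem s 8 0 = int b)"

lemma achieves_empty_prog:
  assumes "emptying n g N b s"
  shows "achieves empty_prog 7 (emptying n g N (Suc b)) s"
proof -
  from assms obtain P where P: "recorded P (imem s)" "emptied n g (int b) P (imem s 9 0) (imem s 4)"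
    "imem s 6 0 = N" "imem s 8 0 = int b" unfolding emptying_def by blast
  have head: "imem s 4 (int b) = 0 \<or> (\<exists>a. imem s 4 (int b) = int a + 1)"
    using P(2) unfolding emptied_def by blast
  have pending: "imem s 9 0 = 0 \<or> (\<exists>p. imem s 9 0 = int p + 1)"
    using P(2) unfolding emptied_def by blast
  have incr: "achieves (iset 8 (IAdd (ivar 8) (IConst 1))) 1 (emptying n g N (Suc b)) s'"
    if "recorded P' (imem s')" "emptied n g (int b + 1) P' (imem s' 9 0) (imem s' 4)"
      "imem s' 6 0 = N" "imem s' 8 0 = int b" for s' P'
    using that by (intro achieves_IPut) (auto simp: emptying_def recorded_def add.commute intro!: exI[of _ P'])
  show ?thesis
    unfolding empty_prog_def
  proof (rule achieves_If[where t = 6])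
    assume "bval (ILess (IConst 0) (IGet 4 (ivar 8))) s"
    then obtain a where a: "imem s 4 (int b) = int a + 1" using head P(4) by auto
    show "achieves (Seq (toggle 9 (IConst 0) (IGet 4 (ivar 8))) (iset 8 (IAdd (ivar 8) (IConst 1)))) 6
        (emptying n g N (Suc b)) s"
    proof (rule achieves_Seq[where t = 5 and u = 1], rule achieves_toggle[OF P(1)])
      show "ival (IConst 0) s' = 0 \<and> ival (IGet 4 (ivar 8)) s' = int a + 1"
        if "\<And>e. e \<notin> {1, 2, 10} \<Longrightarrow> imem s' e = imem s e" for s'
        using that[of 4] that[of 8] P(4) a by simp
      show "imem s 9 0 = 0 \<or> (\<exists>b. imem s 9 0 = int b + 1)" by (rule pending)
    next
      fix s' :: memory assume *: "imem s 9 0 = 0" "recorded P (imem s')" "imem s' 9 = (imem s 9)(0 := int a + 1)"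
        "\<And>e. e \<notin> {1, 2, 10, 9} \<Longrightarrow> imem s' e = imem s e"
      then show "achieves (iset 8 (IAdd (ivar 8) (IConst 1))) 1 (emptying n g N (Suc b)) s'"
        using emptied_store[OF P(2)[unfolded *(1)] a] P(3,4) by (intro incr[of P]) auto
    next
      fix s' :: memory and p assume *: "imem s 9 0 = int p + 1" "recorded (P @ [(p, a)]) (imem s')"
        "imem s' 9 = (imem s 9)(0 := 0)" "\<And>e. e \<notin> {1, 2, 10, 9} \<Longrightarrow> imem s' e = imem s e"
      then show "achieves (iset 8 (IAdd (ivar 8) (IConst 1))) 1 (emptying n g N (Suc b)) s'"
        using emptied_match[OF P(2)[unfolded *(1)] a] P(3,4) by (intro incr[of "P @ [(p, a)]"]) auto
    qed simp_all
  next
    assume "\<not> bval (ILess (IConst 0) (IGet 4 (ivar 8))) s"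
    then have "imem s 4 (int b) = 0" using head P(4) by auto
    from emptied_skip[OF P(2) this] P have "achieves (iset 8 (IAdd (ivar 8) (IConst 1))) 1 (emptying n g N (Suc b)) s"
      by (intro incr) auto
    then show "achieves (iset 8 (IAdd (ivar 8) (IConst 1))) 6 (emptying n g N (Suc b)) s"
      by (rule achieves_mono) auto
  qed simp
qed

lemma achieves_empty_loop:
  assumes "emptying n g (int M) 0 s"
  shows "achieves (While (ILess (ivar 8) (ivar 6))
           empty_prog) (M * 8 + 1) (emptying n g (int M) M) s"
proof (rule achieves_While[where t = 7 and m = M and Inv = "emptying n g (int M)"])
  have guard: "bval (ILess (ivar 8) (ivar 6)) s \<longleftrightarrow> b < M" if "emptying n g (int M) b s" for b s
    using that by (auto simp: emptying_def)
  show "bval (ILess (ivar 8) (ivar 6)) s \<and> achieves empty_prog 7 (emptying n g (int M) (Suc b)) s"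
    if "b < M" "emptying n g (int M) b s" for b and s :: memory
    using that guard achieves_empty_prog by blast
  show "\<not> bval (ILess (ivar 8) (ivar 6)) s" if "emptying n g (int M) M s" for s
    using guard[OF that] by simp
qed (use assms in auto)

section \<open>Size of the grid\<close>

definition refinement_depth :: "nat \<Rightarrow> nat \<Rightarrow> nat" where
  "refinement_depth k n = (LEAST m. n \<le> 3 ^ (k * m))"

lemma refinement_depth:
  assumes "k > 0"
  shows "n \<le> 3 ^ (k * refinement_depth k n)"
    and "l < refinement_depth k n \<Longrightarrow> 3 ^ (k * l) < n"
proof -
  have "n \<le> 3 ^ n" using less_exp[of n] power_mono[of 2 "3::nat" n] by linarith
  also have "(3::nat) ^ n \<le> 3 ^ (k * n)" using assms by (intro power_increasing) auto
  finally show "n \<le> 3 ^ (k * refinement_depth k n)"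
    unfolding refinement_depth_def by (rule LeastI)
  show "l < refinement_depth k n \<Longrightarrow> 3 ^ (k * l) < n"
    unfolding refinement_depth_def using not_less_Least linorder_not_le by blast
qed

text \<open>By minimality the grid one level coarser has fewer than \<open>n\<close> cells, and one
  level multiplies this by \<open>3 ^ k\<close>. Hence there are linearly many buckets and
  logarithmically many rounds.\<close>

lemma refinement_depth_upper:
  assumes "k > 0" "n > 0"
  shows "3 ^ (k * refinement_depth k n) \<le> 3 ^ k * n"
    and "real (refinement_depth k n) \<le> 1 + log 2 (real n)"
proof -
  let ?m = "refinement_depth k n"
  have "3 ^ (k * ?m) \<le> 3 ^ k * n \<and> real ?m \<le> 1 + log 2 (real n)"
  proof (cases ?m)
    case 0
    then show ?thesis using assms by simp
  next
    case (Suc l)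
    have l: "3 ^ (k * l) < n" using refinement_depth(2)[OF assms(1), of l n] Suc by simp
    have "(2::nat) ^ l \<le> 3 ^ l" by (rule power_mono) auto
    also have "\<dots> \<le> 3 ^ (k * l)" using assms by (intro power_increasing) auto
    finally have "2 ^ l \<le> n" using l by simp
    then have "(2::real) ^ l \<le> real n" by (metis of_nat_le_iff of_nat_numeral of_nat_power)
    then have "real l \<le> log 2 (real n)" using assms(2) by (simp add: le_log_iff powr_realpow)
    then show ?thesis using l Suc by (simp add: power_add)
  qed
  then show "3 ^ (k * ?m) \<le> 3 ^ k * n" "real ?m \<le> 1 + log 2 (real n)" by auto
qed

text \<open>Pairs inside cells have gap zero, so the second phase starts with nothing
  charged.\<close>

lemma bucketed_imp_emptying:
  assumes "bucketed g im n s" "im 9 0 = 0" "im 8 0 = 0" "im 6 0 = N"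
    and "\<And>a. a < n \<Longrightarrow> 0 \<le> g a"
  shows "emptying n g N 0 s"
proof -
  from assms(1) obtain P where P: "recorded P (imem s)" "distinct (ends P)" "set (ends P) \<subseteq> {..<n}"
    "\<forall>(a, b)\<in>set P. g a = g b"
    and head: "\<forall>c. imem s 4 c = 0 \<or> (\<exists>a<n. a \<notin> set (ends P) \<and> g a = c \<and> imem s 4 c = int a + 1)"
    and un: "\<forall>a<n. a \<notin> set (ends P) \<longrightarrow> imem s 4 (g a) = int a + 1"
    and fr: "\<And>e. e \<notin> {1, 2, 4, 7, 10} \<Longrightarrow> imem s e = im e"
    unfolding bucketed_def by blast
  have "gap_sum g P = 0" using P(4) unfolding gap_sum_def by (induction P) auto
  then have "emptied n g (int 0) P (imem s 9 0) (imem s 4)"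
    unfolding emptied_def using P head un assms fr by auto
  with P(1) fr assms show ?thesis unfolding emptying_def by (intro exI[of _ P]) auto
qed

lemma length_ends [simp]: "length (ends P) = 2 * length P"
  by (simp add: ends_def)

text \<open>After the last cell at most one point is waiting, and parity excludes it because edges
  cover an even number of points.\<close>

lemma emptying_end:
  assumes "emptying n g N b s" "even n" "\<And>a. a < n \<Longrightarrow> g a < int b"
  obtains P where "recorded P (imem s)" "distinct (ends P)" "set (ends P) = {..<n}" "gap_sum g P \<le> int b"
proof -
  from assms(1) obtain P where P: "recorded P (imem s)" "emptied n g (int b) P (imem s 9 0) (imem s 4)"
    unfolding emptying_def by blast
  then have d: "distinct (ends P)" "set (ends P) \<subseteq> {..<n}" unfolding emptied_def by auto
  have card: "card (set (ends P)) = 2 * length P" using distinct_card[OF d(1)] by simp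
  have "set (ends P) = {..<n} \<and> gap_sum g P \<le> int b"
    using P(2) unfolding emptied_def
  proof (elim conjE disjE exE)
    assume "\<forall>a<n. a \<notin> set (ends P) \<longrightarrow> int b \<le> g a" "gap_sum g P \<le> int b"
    with d(2) assms(3) show ?thesis by fastforce
  next
    fix p assume p: "p < n" "p \<notin> set (ends P)" "\<forall>a<n. a \<notin> set (ends P) \<longrightarrow> a = p \<or> int b \<le> g a"
    then have "{..<n} = insert p (set (ends P))" using d(2) assms(3) by fastforce
    then have "card {..<n} = Suc (card (set (ends P)))" using p(2) by simp
    then have "odd n" using card by simp
    with assms(2) show ?thesis by simp
  qed
  with P(1) d(1) that show ?thesis by blast
qed

text \<open>The phases are verified from last to first, each becoming the postcondition of its
  predecessor.\<close>

lemma achieves_matching_prog: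
  fixes xs :: "(real ^ 'k::finite) list"
  defines "k \<equiv> CARD('k)" and "n \<equiv> length xs"
  defines "m \<equiv> refinement_depth k n"
  defines "g \<equiv> \<lambda>a. peano (sweep k m) (coords (xs ! a))"
  assumes "even n"
  shows "achieves (matching_prog k) (m * (n * (k * (k + 4) + 2) + k + 3) + n * 7 + 3 ^ (k * m) * 8 + 5)
    (\<lambda>s. \<exists>P. recorded P (imem s) \<and> distinct (ends P) \<and> set (ends P) = {..<n} \<and>
            gap_sum g P \<le> 3 ^ (k * m)) (input_memory xs)"
    (is "achieves _ _ ?Q _")
proof -
  let ?M = "3 ^ (k * m) :: nat"
  have k: "k > 0" by (simp add: k_def)
  have gM: "0 \<le> g a" "g a < int ?M" for a
    using peano_bounds[of "sweep k m" "coords (xs ! a)"] by (simp_all add: g_def)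
  have sweep: "achieves (While (ILess (ivar 8) (ivar 6))
           empty_prog) (?M * 8 + 1) ?Q s"
    if "emptying n g (int ?M) 0 s" for s
    by (rule achieves_mono[OF achieves_empty_loop[OF that]])
       (use assms(5) gM in \<open>auto elim!: emptying_end\<close>)
  have bucket: "achieves (Seq (iset 7 (IConst 0)) (Seq (While (ILess (ivar 7) (ivar 0))
           bucket_prog)
         (While (ILess (ivar 8) (ivar 6))
           empty_prog))) (n * 7 + ?M * 8 + 3) ?Q s"
    if s: "\<forall>a<n. imem s 3 (int a) = g a" "imem s 6 0 = int ?M" "imem s 0 0 = int n"
      "imem s 4 = (\<lambda>_. 0)" "imem s 8 0 = 0" "imem s 9 0 = 0" "imem s 10 0 = 0" for s
  proof -
    let ?s = "s\<lparr>imem := (imem s)(7 := (imem s 7)(0 := 0))\<rparr>"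
    have "bucketed g (imem ?s) 0 ?s"
      unfolding bucketed_def using s by (intro exI[of _ "[]"]) (simp add: recorded_def ends_def)
    then have "achieves (While (ILess (ivar 7) (ivar 0))
           bucket_prog) (n * 7 + 1) (bucketed g (imem ?s) n) ?s"
      using s by (intro achieves_bucket_loop) auto
    then have "achieves (While (ILess (ivar 7) (ivar 0))
           bucket_prog) (n * 7 + 1) (emptying n g (int ?M) 0) ?s"
      by (rule achieves_mono) (use s gM in \<open>auto intro: bucketed_imp_emptying\<close>)
    then have 1: "achieves (While (ILess (ivar 7) (ivar 0))
           bucket_prog) (n * 7 + 1)
        (achieves (While (ILess (ivar 8) (ivar 6))
           empty_prog) (?M * 8 + 1) ?Q) ?s"
      by (rule achieves_mono) (rule sweep, auto)
    show ?thesis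
    proof (rule achieves_Seq[where t = 1 and u = "n * 7 + ?M * 8 + 2"], rule achieves_IPut)
      show "achieves (Seq (While (ILess (ivar 7) (ivar 0)) bucket_prog)
          (While (ILess (ivar 8) (ivar 6)) empty_prog)) (n * 7 + ?M * 8 + 2) ?Q
          (s\<lparr>imem := (imem s)(7 := (imem s 7)(ival (IConst 0) s := ival (IConst 0) s))\<rparr>)"
        using 1 by (intro achieves_Seq[where t = "n * 7 + 1" and u = "?M * 8 + 1"]) simp_all
    qed simp_all
  qed
  \<comment> \<open>The integer memory after the first assignment. The zeros of
    \<open>input_memory\<close> serve as initial indices, empty buckets and empty waiting
    slot.\<close>
  define im where "im = (imem (input_memory xs))(6 := (\<lambda>i. if i = 0 then 1 else 0))"
  let ?s = "(input_memory xs)\<lparr>imem := im\<rparr>"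
  have "points_at k n (\<lambda>a. coords (xs ! a)) (\<lambda>_. 0) im ?s"
    by (auto simp: points_at_def im_def input_memory_def n_def k_def coords_def)
  then have "achieves (While (ILess (ivar 6) (ivar 0)) (refine_prog k))
    (m * (n * (k * (k + 4) + 2) + k + 3) + 1)
    (\<lambda>s. (\<forall>a<n. imem s 3 (int a) = peano (sweep k m) (coords (xs ! a))) \<and> imem s 6 0 = 3 ^ (k * m) \<and>
         (\<forall>b. b \<notin> {3, 6, 7} \<longrightarrow> imem s b = im b)) ?s"
  proof (rule achieves_refine_loop)
    show "int n \<le> 3 ^ (k * m)"
      using refinement_depth(1)[OF k, of n] unfolding m_def
      by (metis of_nat_le_iff of_nat_numeral of_nat_power)
    show "3 ^ (k * l) < int n" if "l < m" for l
      using refinement_depth(2)[OF k, of l n] that unfolding m_def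
      by (metis of_nat_less_iff of_nat_numeral of_nat_power)
  qed (auto simp: im_def input_memory_def n_def)
  then have 2: "achieves (While (ILess (ivar 6) (ivar 0)) (refine_prog k))
    (m * (n * (k * (k + 4) + 2) + k + 3) + 1)
    (achieves (Seq (iset 7 (IConst 0)) (Seq (While (ILess (ivar 7) (ivar 0)) bucket_prog)
         (While (ILess (ivar 8) (ivar 6)) empty_prog))) (n * 7 + ?M * 8 + 3) ?Q) ?s"
    by (rule achieves_mono) (rule bucket, auto simp: g_def im_def input_memory_def n_def)
  show ?thesis
    unfolding matching_prog_def
  proof (rule achieves_Seq[where t = 1 and
        u = "(m * (n * (k * (k + 4) + 2) + k + 3) + 1) + (n * 7 + ?M * 8 + 3)"], rule achieves_IPut)
    have "(input_memory xs)\<lparr>imem := (imem (input_memory xs))(6 := (imem (input_memory xs) 6)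
        (ival (IConst 0) (input_memory xs) := ival (IConst 1) (input_memory xs)))\<rparr> = ?s"
      by (auto simp: im_def input_memory_def fun_eq_iff)
    then show "achieves (Seq (While (ILess (ivar 6) (ivar 0)) (refine_prog k))
      (Seq (iset 7 (IConst 0)) (Seq (While (ILess (ivar 7) (ivar 0)) bucket_prog)
         (While (ILess (ivar 8) (ivar 6)) empty_prog))))
      ((m * (n * (k * (k + 4) + 2) + k + 3) + 1) + (n * 7 + ?M * 8 + 3)) ?Q
      ((input_memory xs)\<lparr>imem := (imem (input_memory xs))(6 := (imem (input_memory xs) 6)
        (ival (IConst 0) (input_memory xs) := ival (IConst 1) (input_memory xs)))\<rparr>)"
      using 2 by (simp only:) (rule achieves_Seq, assumption, simp)
  qed simp_all
qed

section \<open>From recorded index pairs to short matchings\<close>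

lemma distinct_ends_imp:
  assumes "distinct (ends P)"
  shows "distinct P" "inj_on fst (set P)" "inj_on snd (set P)" "fst ` set P \<inter> snd ` set P = {}"
  using assms by (auto simp: ends_def distinct_map)

lemma recorded_matching:
  fixes xs :: "(real ^ 'k::finite) list"
  defines "n \<equiv> length xs"
  defines "edge \<equiv> \<lambda>(a, b). {xs ! a, xs ! b}"
  assumes rec: "recorded P (imem s)" and d: "distinct (ends P)" and set: "set (ends P) = {..<n}"
    and xs: "distinct xs"
  shows "outputs_edges xs s (edge ` set P)" "perfect_matching (set xs) (edge ` set P)" "inj_on edge (set P)"
proof -
  note P = distinct_ends_imp[OF d]
  have mem: "fst e < n" "snd e < n" if "e \<in> set P" for e
    using set that by (auto simp: ends_def)
  have nth: "xs ! a = xs ! b \<longleftrightarrow> a = b" if "a < n" "b < n" for a b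
    using that nth_eq_iff_index_eq[OF xs] by (simp add: n_def)
  have cross: "fst e \<noteq> snd e'" if "e \<in> set P" "e' \<in> set P" for e e'
    using P(4) that by blast
  have disj: "e = e'" if "e \<in> set P" "e' \<in> set P" "edge e \<inter> edge e' \<noteq> {}" for e e'
  proof -
    from that(3) have "fst e = fst e' \<or> snd e = snd e' \<or> fst e = snd e' \<or> snd e = fst e'"
      using nth mem[OF that(1)] mem[OF that(2)] unfolding edge_def by (auto split: prod.splits)
    then show ?thesis
      using cross[OF that(1,2)] cross[OF that(2,1)] inj_onD[OF P(2) _ that(1,2)] inj_onD[OF P(3) _ that(1,2)]
      by auto
  qed
  have ne: "edge e \<noteq> {}" for e
    by (auto simp: edge_def split: prod.splits)
  show inj: "inj_on edge (set P)"
    by (rule inj_onI) (use disj ne in blast)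
  have card: "card (edge ` set P) = length P"
    using card_image[OF inj] distinct_card[OF P(1)] by simp
  have cell: "edge (P ! l) = {xs ! nat (imem s 1 (int l)), xs ! nat (imem s 2 (int l))}" if "l < length P" for l
    using rec that by (simp add: recorded_def edge_def split: prod.splits)
  have "bij_betw (\<lambda>l. edge (P ! l)) {..<length P} (edge ` set P)"
    using bij_betw_trans[OF bij_betw_nth[OF P(1) refl refl] inj_on_imp_bij_betw[OF inj]]
    by (simp add: comp_def)
  then have "bij_betw (\<lambda>l. {xs ! nat (imem s 1 (int l)), xs ! nat (imem s 2 (int l))}) {..<length P} (edge ` set P)"
    by (rule bij_betw_cong[THEN iffD1, rotated]) (simp add: cell)
  moreover have "imem s a (int l) \<in> {0..<int (length xs)}" if "a \<in> {1, 2}" "l < length P" for a l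
    using rec that mem[OF nth_mem[OF that(2)]] by (auto simp: recorded_def n_def)
  ultimately show "outputs_edges xs s (edge ` set P)"
    unfolding outputs_edges_def card by blast
  have "\<Union> (edge ` set P) = (!) xs ` set (ends P)"
    by (force simp: edge_def ends_def)
  also have "\<dots> = set xs"
    unfolding set n_def by (auto simp: set_conv_nth)
  finally have "\<Union> (edge ` set P) = set xs" .
  moreover have "disjoint (edge ` set P)"
    unfolding disjoint_def using disj by blast
  ultimately have "partition_on (set xs) (edge ` set P)"
    unfolding partition_on_def by (simp add: image_iff ne[symmetric])
  moreover have "card (edge e) = 2" if "e \<in> set P" for e
    using nth[OF mem[OF that]] cross[OF that that] by (auto simp: edge_def split: prod.splits)
  ultimately show "perfect_matching (set xs) (edge ` set P)"
    unfolding perfect_matching_def by blast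
qed

lemma recorded_short_matching:
  fixes xs :: "(real ^ 'k::finite) list" and s :: memory
  assumes k: "CARD('k) \<ge> 3"
    and rec: "recorded P (imem s)" and d: "distinct (ends P)" and set: "set (ends P) = {..<length xs}"
    and xs: "distinct xs" "set xs \<subseteq> unit_cube"
    and gap: "gap_sum (\<lambda>a. peano (sweep CARD('k) m) (coords (xs ! a))) P \<le> 3 ^ (CARD('k) * m)"
    and len: "length xs \<le> 3 ^ (CARD('k) * m)"
  shows "short_matching (set xs) ((\<lambda>(a, b). {xs ! a, xs ! b}) ` set P)"
proof -
  let ?edge = "\<lambda>(a, b). {xs ! a, xs ! b}"
  let ?es = "map (\<lambda>(a, b). (xs ! a, xs ! b)) P"
  let ?k = "CARD('k)"
  note rm = recorded_matching[OF rec d set xs(1)]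
  have "(\<Sum>e\<in>?edge ` set P. edge_length e ^ ?k) = (\<Sum>e\<in>set P. edge_length (?edge e) ^ ?k)"
    using rm(3) by (simp add: sum.reindex)
  also have "\<dots> = (\<Sum>(x, y)\<leftarrow>?es. dist x y ^ ?k)"
    using distinct_ends_imp(1)[OF d]
    by (simp add: sum_list_distinct_conv_sum_set comp_def split_beta)
  also have "\<dots> \<le> 1 / 3 * (3 * sqrt 5 * sqrt (real ?k)) ^ ?k"
  proof (rule peano_matching_cost[OF k])
    show "x \<in> unit_cube \<and> y \<in> unit_cube" if "(x, y) \<in> set ?es" for x y
    proof -
      from that obtain a b where ab: "(a, b) \<in> set P" "x = xs ! a" "y = xs ! b" by auto
      then have "a \<in> set (ends P)" "b \<in> set (ends P)" by (force simp: ends_def)+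
      then have "xs ! a \<in> set xs" "xs ! b \<in> set xs" unfolding set by auto
      then show ?thesis using xs(2) ab by auto
    qed
    have "length xs = 2 * length P"
      using distinct_card[OF d] set by simp
    then have "length P \<le> 3 ^ (?k * m)" using len by linarith
    then have "int (length P) \<le> int (3 ^ (?k * m))" by (rule of_nat_mono)
    then show "int (length ?es) \<le> 3 ^ (?k * m)" by simp
    show "(\<Sum>(x, y)\<leftarrow>?es. \<bar>peano (sweep ?k m) (coords x) - peano (sweep ?k m) (coords y)\<bar>) \<le> 3 ^ (?k * m)"
      using gap by (simp add: gap_sum_def comp_def case_prod_unfold)
  qed
  finally have sum: "(\<Sum>e\<in>?edge ` set P. edge_length e ^ ?k) \<le> 1 / 3 * (3 * sqrt 5 * sqrt (real ?k)) ^ ?k" .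
  have nonneg: "0 \<le> (\<Sum>e\<in>?edge ` set P. edge_length e ^ ?k)"
    by (intro sum_nonneg) auto
  have "(\<Sum>e\<in>?edge ` set P. edge_length e ^ ?k) powr (1 / real ?k)
      \<le> (3 * sqrt 5 * sqrt (real ?k)) * (1 / 3) powr (1 / real ?k)"
    using k by (intro cost_root_bound sum nonneg) auto
  then show ?thesis
    using rm(2) unfolding short_matching_def by (simp add: mult_ac)
qed

section \<open>Running time of the matching program\<close>

definition matching_time :: "nat \<Rightarrow> nat \<Rightarrow> real" where
  "matching_time k n = real (k * (k + 4) + k + 17 + 8 * 3 ^ k) * (real n * (1 + log 2 (real n)))"

lemma matching_time_bound:
  assumes "k > 0" "n > 0"
  defines "m \<equiv> refinement_depth k n"
  shows "real (m * (n * (k * (k + 4) + 2) + k + 3) + n * 7 + 3 ^ (k * m) * 8 + 5) \<le> matching_time k n"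
proof -
  \<comment> \<open>\<open>?a\<close> covers one round of refinement per point and
    \<open>12 + 8 * 3 ^ k\<close> everything else; the latter may be multiplied by
    \<open>?L \<ge> 1\<close>. Their sum is the constant of \<open>matching_time\<close>.\<close>
  let ?L = "1 + log 2 (real n)" and ?a = "k * (k + 4) + k + 5"
  have L: "1 \<le> ?L" using assms(2) by simp
  have m: "real m \<le> ?L" "3 ^ (k * m) \<le> 3 ^ k * n"
    using refinement_depth_upper[OF assms(1,2)] by (simp_all add: m_def)
  have "n * (k * (k + 4) + 2) + k + 3 \<le> n * (k * (k + 4) + 2) + n * (k + 3)"
    using assms(2) by (cases n) auto
  also have "\<dots> = n * ?a" by (simp add: algebra_simps)
  finally have "m * (n * (k * (k + 4) + 2) + k + 3) \<le> m * (n * ?a)" by (rule mult_le_mono2)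
  moreover have "n * 7 + 3 ^ (k * m) * 8 + 5 \<le> n * (12 + 8 * 3 ^ k)"
    using m(2) assms(2) by (simp add: algebra_simps)
  ultimately have "m * (n * (k * (k + 4) + 2) + k + 3) + n * 7 + 3 ^ (k * m) * 8 + 5
      \<le> m * (n * ?a) + n * (12 + 8 * 3 ^ k)" by linarith
  then have "real (m * (n * (k * (k + 4) + 2) + k + 3) + n * 7 + 3 ^ (k * m) * 8 + 5)
      \<le> real (m * (n * ?a) + n * (12 + 8 * 3 ^ k))"
    by (rule of_nat_mono)
  also have "\<dots> = real m * (real n * real ?a) + real n * real (12 + 8 * 3 ^ k) * 1" by simp
  also have "\<dots> \<le> ?L * (real n * real ?a) + real n * real (12 + 8 * 3 ^ k) * ?L"
    by (intro add_mono mult_right_mono mult_left_mono m L) simp_all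
  also have "\<dots> = matching_time k n" by (simp add: matching_time_def algebra_simps)
  finally show ?thesis .
qed

lemma computes_short_matching:
  assumes k: "CARD('k::finite) \<ge> 3"
  shows "computes_within (matching_prog CARD('k)) {n. n \<ge> 2 \<and> even n}
    (short_matching :: (real ^ 'k) set \<Rightarrow> _) (matching_time CARD('k))"
  unfolding computes_within_def
proof (intro allI impI, elim conjE)
  fix xs :: "(real ^ 'k) list"
  assume xs: "distinct xs" "set xs \<subseteq> unit_cube" "length xs \<in> {n. n \<ge> 2 \<and> even n}"
  let ?k = "CARD('k)" and ?n = "length xs"
  let ?m = "refinement_depth ?k ?n"
  from xs(3) have "even ?n" and n: "?n > 0" by auto
  from achieves_matching_prog[OF this(1)] obtain t s P where
    run: "runs (matching_prog ?k) (input_memory xs) t s"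
      "t \<le> ?m * (?n * (?k * (?k + 4) + 2) + ?k + 3) + ?n * 7 + 3 ^ (?k * ?m) * 8 + 5"
    and P: "recorded P (imem s)" "distinct (ends P)" "set (ends P) = {..<?n}"
      "gap_sum (\<lambda>a. peano (sweep ?k ?m) (coords (xs ! a))) P \<le> 3 ^ (?k * ?m)"
    unfolding achieves_def by blast
  have "real t \<le> matching_time ?k ?n"
    using of_nat_mono[OF run(2), where 'a = real] matching_time_bound[of ?k ?n] n by simp
  moreover have "short_matching (set xs) ((\<lambda>(a, b). {xs ! a, xs ! b}) ` set P)"
    using recorded_short_matching[OF k P(1-3) xs(1,2) P(4)] refinement_depth(1)[of ?k ?n] by simp
  ultimately show "\<exists>t s E. runs (matching_prog ?k) (input_memory xs) t s \<and>
      real t \<le> matching_time ?k ?n \<and> outputs_edges xs s E \<and> short_matching (set xs) E"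
    using run(1) recorded_matching(1)[OF P(1-3) xs(1)] by blast
qed

section \<open>A lower bound for minimum spanning trees\<close>

text \<open>Test results are read off a bit list, so that the real memory becomes irrelevant.\<close>

inductive guided :: "prog \<Rightarrow> (nat \<Rightarrow> int \<Rightarrow> int) \<Rightarrow> bool list \<Rightarrow> (nat \<Rightarrow> int \<Rightarrow> int) \<Rightarrow> bool list \<Rightarrow> bool" where
  IPut: "guided (IPut a i x) im bs
    (im(a := (im a)(ival i \<lparr>imem = im, rmem = \<lambda>_ _. 0\<rparr> := ival x \<lparr>imem = im, rmem = \<lambda>_ _. 0\<rparr>))) bs"
| RPut: "guided (RPut a i y) im bs im bs"
| Seq: "guided p im bs im' bs' \<Longrightarrow> guided q im' bs' im'' bs'' \<Longrightarrow> guided (Seq p q) im bs im'' bs''"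
| IfTrue: "guided p im bs im' bs' \<Longrightarrow> guided (If b p q) im (True # bs) im' bs'"
| IfFalse: "guided q im bs im' bs' \<Longrightarrow> guided (If b p q) im (False # bs) im' bs'"
| WhileFalse: "guided (While b p) im (False # bs) im bs"
| WhileTrue: "guided p im bs im' bs' \<Longrightarrow> guided (While b p) im' bs' im'' bs'' \<Longrightarrow>
    guided (While b p) im (True # bs) im'' bs''"

inductive_cases guided_elims:
  "guided (IPut a i x) im bs im' bs'"
  "guided (RPut a i y) im bs im' bs'"
  "guided (Seq p q) im bs im' bs'"
  "guided (If b p q) im (c # bs) im' bs'"
  "guided (While b p) im (c # bs) im' bs'"

lemma guided_deterministic:
  "guided p im bs im' bs' \<Longrightarrow> guided p im bs im'' bs'' \<Longrightarrow> im' = im'' \<and> bs' = bs''"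
proof (induction arbitrary: im'' bs'' rule: guided.induct)
  case (Seq p im bs im1 bs1 q im2 bs2)
  from Seq.prems show ?case by (rule guided_elims(3)) (use Seq.IH in blast)
next
  case (IfTrue p im bs im' bs' b q)
  from IfTrue.prems show ?case by (rule guided_elims(4)) (use IfTrue.IH in auto)
next
  case (IfFalse q im bs im' bs' b p)
  from IfFalse.prems show ?case by (rule guided_elims(4)) (use IfFalse.IH in auto)
next
  case (WhileTrue p im bs im1 bs1 b im2 bs2)
  from WhileTrue.prems show ?case by (rule guided_elims(5)) (use WhileTrue.IH in blast)+
qed (auto elim: guided_elims)

lemma ival_imem: "imem s = imem s' \<Longrightarrow> ival x s = ival x s'"
  by (induction x) auto

text \<open>Integer expressions never read reals, so reals act on the integer memory only through
  tests. Every test is a step, hence at most \<open>t\<close> bits; the free continuation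
  \<open>r\<close> permits padding to a common length.\<close>

lemma runs_guided:
  "runs p s t s' \<Longrightarrow> \<exists>bs. length bs \<le> t \<and> (\<forall>r. guided p (imem s) (bs @ r) (imem s') r)"
proof (induction rule: runs.induct)
  case (IPut a i x s)
  have "ival i s = ival i \<lparr>imem = imem s, rmem = \<lambda>_ _. 0\<rparr>" "ival x s = ival x \<lparr>imem = imem s, rmem = \<lambda>_ _. 0\<rparr>"
    by (rule ival_imem, simp)+
  then show ?case
    by (intro exI[of _ "[]"] conjI allI)
       (use guided.IPut[of a i x "imem s"] in \<open>simp_all add: fun_upd_def\<close>)
next
  case (RPut a i x s)
  show ?case by (intro exI[of _ "[]"]) (auto intro: guided.RPut)
next
  case (Seq p s t s' q u s'')
  then obtain bs cs where "length bs \<le> t" "\<And>r. guided p (imem s) (bs @ r) (imem s') r"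
    "length cs \<le> u" "\<And>r. guided q (imem s') (cs @ r) (imem s'') r" by blast
  then show ?case by (intro exI[of _ "bs @ cs"]) (auto intro: guided.Seq)
next
  case (IfTrue b s p t s' q)
  then obtain bs where "length bs \<le> t" "\<And>r. guided p (imem s) (bs @ r) (imem s') r" by blast
  then show ?case by (intro exI[of _ "True # bs"]) (auto intro: guided.IfTrue)
next
  case (IfFalse b s q t s' p)
  then obtain bs where "length bs \<le> t" "\<And>r. guided q (imem s) (bs @ r) (imem s') r" by blast
  then show ?case by (intro exI[of _ "False # bs"]) (auto intro: guided.IfFalse)
next
  case (WhileFalse b s p)
  show ?case by (intro exI[of _ "[False]"]) (auto intro: guided.WhileFalse)
next
  case (WhileTrue b s p t s' u s'')
  then obtain bs cs where "length bs \<le> t" "\<And>r. guided p (imem s) (bs @ r) (imem s') r"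
    "length cs \<le> u" "\<And>r. guided (While b p) (imem s') (cs @ r) (imem s'') r" by blast
  then show ?case by (intro exI[of _ "True # bs @ cs"]) (auto intro: guided.WhileTrue)
qed

text \<open>Only the initial integer memory is fixed. The reals vary freely, yet the bits of the
  tests determine the final integer memory.\<close>

lemma card_reachable_imem:
  fixes p :: prog and im :: "nat \<Rightarrow> int \<Rightarrow> int" and \<tau> :: nat
  defines "R \<equiv> {imem s' | s s' t. imem s = im \<and> runs p s t s' \<and> t \<le> \<tau>}"
  shows "finite R \<and> card R \<le> 2 ^ \<tau>"
proof -
  let ?B = "{bs :: bool list. set bs \<subseteq> UNIV \<and> length bs = \<tau>}"
  \<comment> \<open>Lists that guide no run get an arbitrary value; for an upper bound it suffices
    that every reachable memory is hit.\<close>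
  define f where "f = (\<lambda>bs. THE im'. \<exists>r. guided p im bs im' r)"
  have "R \<subseteq> f ` ?B"
  proof
    fix im' assume "im' \<in> R"
    then obtain s s' t where s: "imem s = im" "runs p s t s'" "t \<le> \<tau>" "im' = imem s'"
      by (auto simp: R_def)
    from runs_guided[OF s(2)] obtain bs where
      bs: "length bs \<le> t" "\<And>r. guided p im (bs @ r) im' r" using s by auto
    let ?bs = "bs @ replicate (\<tau> - length bs) True"
    have "f ?bs = im'"
      unfolding f_def by (rule the_equality) (use bs(2) guided_deterministic in blast)+
    moreover have "?bs \<in> ?B" using bs(1) s(3) by simp
    ultimately show "im' \<in> f ` ?B" by (intro image_eqI[of _ _ ?bs]) simp_all
  qed
  moreover have "finite ?B" by (rule finite_lists_length_eq) simp
  moreover have "card ?B = 2 ^ \<tau>" using card_lists_length_eq[of "UNIV :: bool set" \<tau>] by simp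
  ultimately show ?thesis
    using card_mono[of "f ` ?B" R] card_image_le[of ?B f] finite_subset[of R "f ` ?B"] by simp
qed

section \<open>Spanning trees of equally spaced points on the diagonal\<close>

definition grid_point :: "nat \<Rightarrow> nat \<Rightarrow> real ^ 'k" where
  "grid_point n v = real v *\<^sub>R (\<chi> _. 1 / real n)"

definition grid_path :: "nat \<Rightarrow> (real ^ 'k) set set" where
  "grid_path n = {{grid_point n v, grid_point n (Suc v)} | v. Suc v < n}"

definition grid_step :: "'k::finite itself \<Rightarrow> nat \<Rightarrow> real" where
  "grid_step _ n = norm ((\<chi> _. 1 / real n) :: real ^ 'k)"

lemma grid_step_pos: "n > 0 \<Longrightarrow> grid_step TYPE('k::finite) n > 0"
  by (auto simp: grid_step_def vec_eq_iff)

lemma dist_grid_point: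
  "dist (grid_point n v) (grid_point n w :: real ^ 'k::finite)
     = \<bar>real v - real w\<bar> * grid_step TYPE('k) n"
  by (simp add: grid_point_def dist_norm scaleR_left_diff_distrib[symmetric] grid_step_def del: scaleR_left_diff_distrib)

lemma grid_point_eq_iff:
  assumes "n > 0"
  shows "grid_point n v = (grid_point n w :: real ^ 'k::finite) \<longleftrightarrow> v = w"
proof -
  have "grid_point n v = (grid_point n w :: real ^ 'k) \<longleftrightarrow> \<bar>real v - real w\<bar> * grid_step TYPE('k) n = 0"
    unfolding dist_grid_point[symmetric] by simp
  then show ?thesis using grid_step_pos[OF assms, where 'k = 'k] by simp
qed

lemma grid_point_in_cube: "v < n \<Longrightarrow> grid_point n v \<in> unit_cube"
  by (simp add: unit_cube_def grid_point_def)

lemma grid_path_edge_iff: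
  assumes "n > 0" "v < n" "w < n"
  shows "{grid_point n v, grid_point n w :: real ^ 'k::finite} \<in> grid_path n \<longleftrightarrow> w = Suc v \<or> v = Suc w"
  using assms by (auto simp: grid_path_def doubleton_eq_iff grid_point_eq_iff)

text \<open>A cycle would have a highest vertex, and its two distinct neighbours on the cycle would
  both have to be the grid point just below.\<close>

lemma spanning_tree_grid_path:
  assumes "n > 0"
  shows "spanning_tree (grid_point n ` {..<n} :: (real ^ 'k::finite) set) (grid_path n)"
  unfolding spanning_tree_def
proof (intro conjI notI)
  let ?p = "grid_point n :: nat \<Rightarrow> real ^ 'k"
  let ?R = "{(u, v). {u, v} \<in> (grid_path n :: (real ^ 'k) set set)}"
  note eq = grid_point_eq_iff[OF assms, where 'k = 'k]
  show "grid_path n \<subseteq> complete_edges (?p ` {..<n})"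
    by (auto simp: grid_path_def complete_edges_def eq)
  show "connected_graph (?p ` {..<n}) (grid_path n)"
  proof -
    have "sym (?R\<^sup>*)" by (rule sym_rtrancl) (auto simp: sym_def insert_commute)
    moreover have 0: "(?p 0, ?p v) \<in> ?R\<^sup>*" if "v < n" for v
      using that
    proof (induction v)
      case (Suc v)
      then have "(?p v, ?p (Suc v)) \<in> ?R" by (auto simp: grid_path_def)
      with Suc show ?case by (auto intro: rtrancl_into_rtrancl)
    qed simp
    ultimately have "(?p v, ?p w) \<in> ?R\<^sup>*" if "v < n" "w < n" for v w
      using that by (meson rtrancl_trans symE)
    then show ?thesis using assms unfolding connected_graph_def by auto
  qed
  assume "\<exists>vs. graph_cycle (grid_path n :: (real ^ 'k) set set) vs"
  then obtain vs where vs: "length vs \<ge> 3" "distinct vs" "{last vs, hd vs} \<in> (grid_path n :: (real ^ 'k) set set)"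
    "\<And>i. Suc i < length vs \<Longrightarrow> {vs ! i, vs ! Suc i} \<in> (grid_path n :: (real ^ 'k) set set)"
    unfolding graph_cycle_def by blast
  let ?L = "length vs"
  have vs0: "{vs ! (?L - 1), vs ! 0} \<in> (grid_path n :: (real ^ 'k) set set)"
  proof -
    have "vs \<noteq> []" using vs(1) by auto
    then show ?thesis using vs(3) by (simp add: last_conv_nth hd_conv_nth)
  qed
  have "\<exists>v<n. vs ! i = ?p v" if "i < ?L" for i
  proof (cases "Suc i < ?L")
    case True
    from vs(4)[OF this] show ?thesis by (auto simp: grid_path_def doubleton_eq_iff dest: Suc_lessD)
  next
    case False
    with that have "i = ?L - 1" by simp
    with vs0 show ?thesis by (auto simp: grid_path_def doubleton_eq_iff dest: Suc_lessD)
  qed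
  then obtain h where h: "\<And>i. i < ?L \<Longrightarrow> h i < n \<and> vs ! i = ?p (h i)" by metis
  have adj: "h j = Suc (h i) \<or> h i = Suc (h j)"
    if "i < ?L" "j < ?L" "{vs ! i, vs ! j} \<in> (grid_path n :: (real ^ 'k) set set)" for i j
    using that h grid_path_edge_iff[OF assms, where 'k = 'k] by metis
  have "0 \<in> {..<?L}" using vs(1) by auto
  then have "finite (h ` {..<?L})" "h ` {..<?L} \<noteq> {}" by blast+
  then have "Max (h ` {..<?L}) \<in> h ` {..<?L}" by (rule Max_in)
  then obtain i where i1: "i < ?L" "h i = Max (h ` {..<?L})" by force
  have i: "i < ?L" "\<And>j. j < ?L \<Longrightarrow> h j \<le> h i" using i1 by auto
  \<comment> \<open>\<open>j\<close> and \<open>l\<close> are the cyclic neighbours of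
    \<open>i\<close>; they differ because a cycle has at least three vertices.\<close>
  define j where "j = (if Suc i < ?L then Suc i else 0)"
  define l where "l = (if i = 0 then ?L - 1 else i - 1)"
  have jl: "j < ?L" "l < ?L" "j \<noteq> l" using i(1) vs(1) by (auto simp: j_def l_def)
  have "{vs ! i, vs ! j} \<in> grid_path n"
  proof (cases "Suc i < ?L")
    case False
    with i(1) have "i = ?L - 1" by simp
    with vs0 False show ?thesis by (simp add: j_def)
  qed (use vs(4) in \<open>simp add: j_def\<close>)
  moreover have "{vs ! i, vs ! l} \<in> grid_path n"
    using vs0 vs(4)[of "i - 1"] i(1) by (auto simp: l_def insert_commute)
  ultimately have "h i = Suc (h j)" "h i = Suc (h l)"
    using adj[of i j] adj[of i l] i(2)[OF jl(1)] i(2)[OF jl(2)] i(1) jl by auto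
  then have "vs ! j = vs ! l" using h[OF jl(1)] h[OF jl(2)] by simp
  with vs(2) jl show False by (simp add: nth_eq_iff_index_eq)
qed

text \<open>Edge lengths on the line are proportional to the number of cuts \<open>v | v + 1\<close> that the edge crosses,
  and a connected graph crosses every cut.\<close>

lemma euclidean_mst_grid:
  fixes E :: "(real ^ 'k::finite) set set"
  assumes n: "n > 0" and mst: "euclidean_mst (grid_point n ` {..<n}) E"
  shows "E = grid_path n"
proof -
  let ?p = "grid_point n :: nat \<Rightarrow> real ^ 'k" and ?d = "grid_step TYPE('k) n"
  note eq = grid_point_eq_iff[OF n, where 'k = 'k]
  define crosses where "crosses = (\<lambda>j e. \<exists>a b. a \<le> j \<and> j < b \<and> b < n \<and> e = {?p a, ?p b})"
  have E: "E \<subseteq> complete_edges (?p ` {..<n})" "connected_graph (?p ` {..<n}) E"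
    using mst unfolding euclidean_mst_def spanning_tree_def by auto
  have finE: "finite E"
    by (rule finite_subset[of _ "Pow (?p ` {..<n})"]) (use E(1) in \<open>auto simp: complete_edges_def\<close>)
  have edgeE: "\<exists>a b. a < b \<and> b < n \<and> e = {?p a, ?p b}" if "e \<in> complete_edges (?p ` {..<n})" for e
  proof -
    from that obtain x y where "e = {x, y}" "x \<noteq> y" "e \<subseteq> ?p ` {..<n}"
      by (auto simp: complete_edges_def card_2_iff)
    then obtain a b where "e = {?p a, ?p b}" "a < n" "b < n" "a \<noteq> b" by auto
    then show ?thesis by (metis insert_commute nat_neq_iff)
  qed
  have crosses_iff: "crosses j {?p a, ?p b} \<longleftrightarrow> a \<le> j \<and> j < b" if "a < b" "b < n" for a b j
    using that by (auto simp: crosses_def doubleton_eq_iff eq)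
  have len: "edge_length e = ?d * (\<Sum>j<n - 1. of_bool (crosses j e))"
    if "e \<in> complete_edges (?p ` {..<n})" for e
  proof -
    from edgeE[OF that] obtain a b where ab: "a < b" "b < n" "e = {?p a, ?p b}" by blast
    have "(\<Sum>j<n - 1. of_bool (crosses j e)) = (\<Sum>j<n - 1. of_bool (j \<in> {a..<b}) :: real)"
      using crosses_iff[OF ab(1,2)] by (simp add: ab(3))
    also have "\<dots> = real (card ({..<n - 1} \<inter> {a..<b}))"
      by (simp add: Int_def)
    also have "{..<n - 1} \<inter> {a..<b} = {a..<b}" using ab by auto
    finally show ?thesis using ab by (simp add: dist_grid_point mult.commute)
  qed
  have cost: "(\<Sum>e\<in>F. edge_length e) = ?d * (\<Sum>j<n - 1. real (card {e \<in> F. crosses j e}))"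
    if "F \<subseteq> complete_edges (?p ` {..<n})" "finite F" for F
  proof -
    have "(\<Sum>e\<in>F. edge_length e) = (\<Sum>e\<in>F. ?d * (\<Sum>j<n - 1. of_bool (crosses j e)))"
      using len that by (intro sum.cong) auto
    \<comment> \<open>Exchanging the sums counts the crossings cut by cut.\<close>
    also have "\<dots> = ?d * (\<Sum>j<n - 1. \<Sum>e\<in>F. of_bool (crosses j e))"
      unfolding sum_distrib_left[symmetric] by (subst sum.swap) simp
    finally show ?thesis using that(2) by (simp add: Int_def)
  qed
  have path: "spanning_tree (?p ` {..<n}) (grid_path n)" by (rule spanning_tree_grid_path[OF n])
  have pathE: "grid_path n \<subseteq> complete_edges (?p ` {..<n})" using path by (simp add: spanning_tree_def)
  have finP: "finite (grid_path n :: (real ^ 'k) set set)"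
    by (rule finite_subset[of _ "Pow (?p ` {..<n})"]) (use pathE in \<open>auto simp: complete_edges_def\<close>)
  have "card {e \<in> grid_path n. crosses j e} = 1" if "j < n - 1" for j
  proof -
    have "{e \<in> grid_path n. crosses j e} = {{?p j, ?p (Suc j)}}"
    proof (intro equalityI subsetI)
      fix e assume "e \<in> {e \<in> grid_path n. crosses j e}"
      then obtain v where "Suc v < n" "e = {?p v, ?p (Suc v)}" "crosses j e" by (auto simp: grid_path_def)
      then show "e \<in> {{?p j, ?p (Suc j)}}" using crosses_iff[of v "Suc v" j] by (auto simp: le_less_Suc_eq)
    next
      fix e assume "e \<in> {{?p j, ?p (Suc j)}}"
      then show "e \<in> {e \<in> grid_path n. crosses j e}"
        using that crosses_iff[of j "Suc j" j] by (auto simp: grid_path_def)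
    qed
    then show ?thesis by simp
  qed
  then have "(\<Sum>e\<in>grid_path n. edge_length (e :: (real ^ 'k) set)) = ?d * real (n - 1)"
    using cost[OF pathE finP] by simp
  then have "?d * (\<Sum>j<n - 1. real (card {e \<in> E. crosses j e})) \<le> ?d * real (n - 1)"
    using mst path cost[OF E(1) finE] unfolding euclidean_mst_def by force
  then have le: "(\<Sum>j<n - 1. card {e \<in> E. crosses j e}) \<le> n - 1"
    using grid_step_pos[OF n, where 'k = 'k]
    by (simp add: of_nat_sum[symmetric] del: of_nat_sum)
  have ge: "card {e \<in> E. crosses j e} \<ge> 1" if j: "j < n - 1" for j
  proof -
    let ?R = "{(u, v). {u, v} \<in> E}"
    have path: "(?p j, ?p (Suc j)) \<in> ?R\<^sup>*"
      using E(2) j unfolding connected_graph_def by auto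
    have "\<exists>e\<in>E. crosses j e"
    proof (rule ccontr)
      \<comment> \<open>Without a crossing edge, no walk from point \<open>j\<close> leaves the
        points up to \<open>j\<close>.\<close>
      assume no: "\<not> (\<exists>e\<in>E. crosses j e)"
      have "z \<in> ?p ` {..j}" if "(?p j, z) \<in> ?R\<^sup>*" for z
        using that
      proof (induction rule: rtrancl_induct)
        case (step y z)
        then obtain a where a: "a \<le> j" "y = ?p a" by auto
        have "{y, z} \<in> E" using step by simp
        with E(1) edgeE obtain a' b where b: "a' < b" "b < n" "{y, z} = {?p a', ?p b}" by blast
        have "\<not> crosses j {?p a', ?p b}" using no \<open>{y, z} \<in> E\<close> b(3) by auto
        then have "\<not> (a' \<le> j \<and> j < b)" using crosses_iff[OF b(1,2)] by simp
        then show ?case using a b by (auto simp: doubleton_eq_iff eq)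
      qed simp
      from this[OF path] show False by (auto simp: eq)
    qed
    then have "{e \<in> E. crosses j e} \<noteq> {}" by blast
    then show ?thesis using finE by (simp add: Suc_le_eq card_gt_0_iff)
  qed
  \<comment> \<open>With \<open>n - 1\<close> cuts and at most \<open>n - 1\<close> crossings in
    total, no cut can be crossed twice.\<close>
  have one: "card {e \<in> E. crosses j e} = 1" if j: "j < n - 1" for j
  proof (rule ccontr)
    assume "card {e \<in> E. crosses j e} \<noteq> 1"
    with ge[OF j] have "1 < card {e \<in> E. crosses j e}" by simp
    then have "(\<Sum>j<n - 1. 1) < (\<Sum>j<n - 1. card {e \<in> E. crosses j e})"
      using j ge by (intro sum_strict_mono_ex1) auto
    with le show False by simp
  qed
  have uniq: "e = e'" if "j < n - 1" "e \<in> E" "e' \<in> E" "crosses j e" "crosses j e'" for j e e'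
    using one[OF that(1)] that by (auto simp: card_1_singleton_iff)
  have incident: "\<exists>w. {?p v, w} \<in> E" if v: "v < n" "n > 1" for v
  proof -
    obtain w where w: "w < n" "w \<noteq> v" using v by (metis less_trans zero_less_one nat_neq_iff)
    then have "(?p v, ?p w) \<in> {(u, v). {u, v} \<in> E}\<^sup>*"
      using E(2) v unfolding connected_graph_def by auto
    then show ?thesis
      by (cases rule: converse_rtranclE) (use w eq in auto)
  qed
  have consecutive: "{?p j, ?p (Suc j)} \<in> E" if j: "j < n - 1" for j
  proof -
    from ge[OF j] obtain e where e: "e \<in> E" "crosses j e"
      by (metis (mono_tags, lifting) card.empty empty_Collect_eq not_one_le_zero)
    then obtain a b where ab: "a \<le> j" "j < b" "b < n" "e = {?p a, ?p b}" by (auto simp: crosses_def)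
    have "b = Suc j"
    proof (rule ccontr)
      \<comment> \<open>Then \<open>e\<close> passes over the point \<open>j + 1\<close> and is the
        only edge over cuts \<open>j\<close> and \<open>j + 1\<close>. But \<open>j + 1\<close> has
        an incident edge, which crosses one of these cuts and is not \<open>e\<close>.\<close>
      assume "b \<noteq> Suc j"
      with ab have b: "Suc j < b" by simp
      obtain w where w: "{?p (Suc j), w} \<in> E" using incident[of "Suc j"] j by fastforce
      from edgeE[of "{?p (Suc j), w}"] E(1) w obtain a' b' where
        ab': "a' < b'" "b' < n" "{?p (Suc j), w} = {?p a', ?p b'}" by blast
      then have "a' = Suc j \<or> b' = Suc j" by (auto simp: doubleton_eq_iff eq)
      then have "crosses j {?p a', ?p b'} \<or> crosses (Suc j) {?p a', ?p b'}"
        unfolding crosses_iff[OF ab'(1,2)] using ab'(1) by linarith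
      moreover have "crosses (Suc j) e" using ab b crosses_iff[of a b "Suc j"] by auto
      ultimately have "e = {?p (Suc j), w}"
        using uniq[OF j e(1) w e(2)] uniq[OF _ e(1) w, of "Suc j"] ab'(3) ab(3) b by force
      then show False using ab b by (auto simp: doubleton_eq_iff eq)
    qed
    moreover have "a = j"
    proof (rule ccontr)
      \<comment> \<open>The mirrored argument, at point \<open>j\<close> with the cuts
        \<open>j - 1\<close> and \<open>j\<close>.\<close>
      assume "a \<noteq> j"
      with ab have a: "a < j" by simp
      obtain w where w: "{?p j, w} \<in> E" using incident[of j] j by fastforce
      from edgeE[of "{?p j, w}"] E(1) w obtain a' b' where
        ab': "a' < b'" "b' < n" "{?p j, w} = {?p a', ?p b'}" by blast
      then have "a' = j \<or> b' = j" by (auto simp: doubleton_eq_iff eq)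
      then have "crosses j {?p a', ?p b'} \<or> crosses (j - 1) {?p a', ?p b'}"
        unfolding crosses_iff[OF ab'(1,2)] using ab'(1) a by linarith
      moreover have "crosses (j - 1) e" using ab a crosses_iff[of a b "j - 1"] by simp linarith
      ultimately have "e = {?p j, w}"
        using uniq[OF j e(1) w e(2)] uniq[OF _ e(1) w, of "j - 1"] ab'(3) j by force
      then show False using ab a by (auto simp: doubleton_eq_iff eq)
    qed
    ultimately show ?thesis using e ab by simp
  qed
  show ?thesis
  proof (intro equalityI subsetI)
    fix e assume "e \<in> E"
    with E(1) edgeE obtain a b where ab: "a < b" "b < n" "e = {?p a, ?p b}" by blast
    have a: "a < n - 1" "Suc a < n" using ab by auto
    \<comment> \<open>Every edge crosses the cut just above its lower end, where the single edge is
      already known.\<close>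
    have "crosses a e" unfolding ab(3) crosses_iff[OF ab(1,2)] using ab(1) by simp
    moreover have "crosses a {?p a, ?p (Suc a)}" unfolding crosses_iff[OF lessI a(2)] by simp
    ultimately have "e = {?p a, ?p (Suc a)}"
      by (rule uniq[OF a(1) \<open>e \<in> E\<close> consecutive[OF a(1)]])
    with a(2) show "e \<in> grid_path n" unfolding grid_path_def by blast
  next
    fix e :: "(real ^ 'k) set" assume "e \<in> grid_path n"
    then show "e \<in> E" using consecutive by (auto simp: grid_path_def)
  qed
qed

text \<open>The edges at a vertex of a path lead to the previous vertex, already visited, and to the
  next one, which is thereby forced. The common start rules out the reversed path.\<close>

lemma permutation_of_edges_unique:
  fixes \<rho> \<rho>' :: "nat \<Rightarrow> 'a"
  assumes inj: "inj_on \<rho> {..<n}" "inj_on \<rho>' {..<n}" and start: "\<rho> 0 = \<rho>' 0"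
    and edges: "(\<lambda>v. {\<rho> v, \<rho> (Suc v)}) ` {..<n - 1} = (\<lambda>v. {\<rho>' v, \<rho>' (Suc v)}) ` {..<n - 1}"
    and "v < n"
  shows "\<rho> v = \<rho>' v"
  using \<open>v < n\<close>
proof (induction v rule: less_induct)
  case (less v)
  show ?case
  proof (cases v)
    case (Suc u)
    then have u: "u < n - 1" "u < n" "\<rho> u = \<rho>' u" using less by auto
    then have "{\<rho> u, \<rho> (Suc u)} \<in> (\<lambda>v. {\<rho>' v, \<rho>' (Suc v)}) ` {..<n - 1}"
      using edges by blast
    then obtain w where w: "w < n - 1" "{\<rho> u, \<rho> (Suc u)} = {\<rho>' w, \<rho>' (Suc w)}" by auto
    then consider "\<rho> u = \<rho>' w" "\<rho> (Suc u) = \<rho>' (Suc w)" | "\<rho> u = \<rho>' (Suc w)" "\<rho> (Suc u) = \<rho>' w"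
      by (auto simp: doubleton_eq_iff)
    then show ?thesis
    proof cases
      case 1
      then have "u = w" using inj_onD[OF inj(2), of u w] u w by auto
      with 1 Suc show ?thesis by simp
    next
      \<comment> \<open>The second path uses this edge backwards. Then \<open>\<rho> (Suc u)\<close>
        would repeat the earlier value \<open>\<rho> w\<close>, against injectivity.\<close>
      case 2
      then have "u = Suc w" using inj_onD[OF inj(2), of u "Suc w"] u w by auto
      moreover from this have "\<rho> w = \<rho>' w" using less.IH[of w] Suc u by simp
      ultimately have "Suc u = w" using inj_onD[OF inj(1), of "Suc u" w] 2 u w less.prems Suc by auto
      with \<open>u = Suc w\<close> show ?thesis by simp
    qed
  qed (simp add: start)
qed

text \<open>The inverse makes \<open>\<rho> v\<close> the list position of grid point
  \<open>v\<close>.\<close>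

definition shuffled_grid :: "nat \<Rightarrow> (nat \<Rightarrow> nat) \<Rightarrow> (real ^ 'k) list" where
  "shuffled_grid n \<rho> = map (\<lambda>i. grid_point n (inv \<rho> i)) [0..<n]"

definition index_edges :: "nat \<Rightarrow> (nat \<Rightarrow> int \<Rightarrow> int) \<Rightarrow> nat set set" where
  "index_edges n im = (\<lambda>j. {nat (im 1 (int j)), nat (im 2 (int j))}) ` {..<n - 1}"

lemma grid_path_image: "grid_path n = (\<lambda>v. {grid_point n v, grid_point n (Suc v)}) ` {..<n - 1}"
  by (auto simp: grid_path_def)

lemma index_edges_shuffled_grid:
  assumes n: "n > 0" and \<rho>: "\<rho> permutes {..<n}"
    and out: "outputs_edges (shuffled_grid n \<rho> :: (real ^ 'k::finite) list) s (grid_path n)"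
  shows "index_edges n (imem s) = (\<lambda>v. {\<rho> v, \<rho> (Suc v)}) ` {..<n - 1}"
proof -
  let ?p = "grid_point n :: nat \<Rightarrow> real ^ 'k" and ?xs = "shuffled_grid n \<rho> :: (real ^ 'k) list"
  let ?a = "\<lambda>j. nat (imem s 1 (int j))" and ?b = "\<lambda>j. nat (imem s 2 (int j))"
  note eq = grid_point_eq_iff[OF n, where 'k = 'k]
  have injp: "inj ?p" by (rule injI) (simp add: eq)
  have "inj_on (\<lambda>v. {?p v, ?p (Suc v)}) {..<n - 1}"
    by (rule inj_onI) (auto simp: doubleton_eq_iff eq)
  then have card: "card (grid_path n :: (real ^ 'k) set set) = n - 1"
    by (simp add: grid_path_image card_image)
  have lt: "?a j < n" "?b j < n" if "j < n - 1" for j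
    using out that n unfolding outputs_edges_def card by (force simp: shuffled_grid_def)+
  \<comment> \<open>Takes a grid point to its position in the list and so turns edges between points
    into edges between indices.\<close>
  define \<psi> where "\<psi> = (\<lambda>x. \<rho> (inv ?p x))"
  have \<psi>: "\<psi> (?p v) = \<rho> v" for v using injp by (simp add: \<psi>_def)
  have \<psi>xs: "\<psi> (?xs ! i) = i" if "i < n" for i
    using that permutes_inverses(1)[OF \<rho>] by (simp add: shuffled_grid_def \<psi>)
  have "(\<lambda>j. {?xs ! ?a j, ?xs ! ?b j}) ` {..<n - 1} = grid_path n"
    using out unfolding outputs_edges_def card bij_betw_def by blast
  then have "(\<lambda>e. \<psi> ` e) ` (\<lambda>j. {?xs ! ?a j, ?xs ! ?b j}) ` {..<n - 1}
      = (\<lambda>e. \<psi> ` e) ` (\<lambda>v. {?p v, ?p (Suc v)}) ` {..<n - 1}"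
    by (simp only: grid_path_image)
  moreover have "(\<lambda>e. \<psi> ` e) ` (\<lambda>j. {?xs ! ?a j, ?xs ! ?b j}) ` {..<n - 1} = index_edges n (imem s)"
    unfolding index_edges_def image_image
  proof (rule image_cong)
    fix j assume "j \<in> {..<n - 1}"
    then have "j < n - 1" by simp
    from \<psi>xs[OF lt(1)[OF this]] \<psi>xs[OF lt(2)[OF this]]
    show "\<psi> ` {?xs ! ?a j, ?xs ! ?b j} = {?a j, ?b j}" by simp
  qed simp
  moreover have "(\<lambda>e. \<psi> ` e) ` (\<lambda>v. {?p v, ?p (Suc v)}) ` {..<n - 1} = (\<lambda>v. {\<rho> v, \<rho> (Suc v)}) ` {..<n - 1}"
    unfolding image_image by (simp add: \<psi>)
  ultimately show ?thesis by simp
qed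

text \<open>The index edges of the minimum spanning tree determine the shuffle up to its first value, which
  costs a factor \<open>n\<close>.\<close>

lemma mst_time_lower_bound:
  fixes T :: "nat \<Rightarrow> real"
  assumes q: "computes_within q {n. n \<ge> 2} (euclidean_mst :: (real ^ 'k::finite) set \<Rightarrow> _) T" and n: "n \<ge> 2"
  shows "fact (n - 1) \<le> 2 powr T n"
proof -
  define \<tau> where "\<tau> = nat \<lfloor>T n\<rfloor>"
  \<comment> \<open>The only integer input is \<open>n\<close>, so all shuffles start from the same
    integer memory.\<close>
  define im0 :: "nat \<Rightarrow> int \<Rightarrow> int" where "im0 = (\<lambda>a i. if a = 0 \<and> i = 0 then int n else 0)"
  define R where "R = {imem s' | s s' t. imem s = im0 \<and> runs q s t s' \<and> t \<le> \<tau>}"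
  have R: "finite R" "card R \<le> 2 ^ \<tau>"
    using card_reachable_imem[of im0 q \<tau>] by (simp_all add: R_def)
  let ?G = "\<lambda>\<rho> :: nat \<Rightarrow> nat. (\<lambda>v. {\<rho> v, \<rho> (Suc v)}) ` {..<n - 1}"
  let ?Perms = "{\<rho>. \<rho> permutes {..<n}}"
  \<comment> \<open>\<open>0 \<le> T n\<close> is recorded because \<open>nat\<close> sends negative
    integers to zero, and \<open>\<tau>\<close> must not exceed \<open>T n\<close>.\<close>
  have run: "0 \<le> T n \<and> (\<exists>im\<in>R. index_edges n im = ?G \<rho>)" if \<rho>: "\<rho> permutes {..<n}" for \<rho>
  proof -
    let ?xs = "shuffled_grid n \<rho> :: (real ^ 'k) list"
    have n0: "n > 0" using n by simp
    have len: "length ?xs = n" by (simp add: shuffled_grid_def)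
    have "set ?xs = grid_point n ` (inv \<rho> ` {..<n})"
      by (auto simp: shuffled_grid_def image_image)
    also have "inv \<rho> ` {..<n} = {..<n}" using permutes_inv[OF \<rho>] by (rule permutes_image)
    finally have set: "set ?xs = grid_point n ` {..<n}" .
    have "inj (inv \<rho>)" using permutes_inv[OF \<rho>] by (rule permutes_inj)
    then have "distinct ?xs"
      by (auto simp: shuffled_grid_def distinct_map inj_on_def grid_point_eq_iff[OF n0])
    moreover have "set ?xs \<subseteq> unit_cube" unfolding set by (auto intro: grid_point_in_cube)
    ultimately have "distinct ?xs \<and> set ?xs \<subseteq> unit_cube \<and> length ?xs \<in> {n. n \<ge> 2}"
      using n len by simp
    from q[unfolded computes_within_def, rule_format, OF this] obtain t s E where
      *: "runs q (input_memory ?xs) t s" "real t \<le> T n" "outputs_edges ?xs s E" "euclidean_mst (set ?xs) E"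
      unfolding len by blast
    have "E = grid_path n" using euclidean_mst_grid[OF n0] *(4) unfolding set by blast
    then have "index_edges n (imem s) = ?G \<rho>" using index_edges_shuffled_grid[OF n0 \<rho>] *(3) by blast
    moreover have "imem s \<in> R"
    proof -
      have "t \<le> \<tau>" using *(2) by (simp add: \<tau>_def le_nat_floor)
      moreover have "imem (input_memory ?xs) = im0" by (simp add: input_memory_def im0_def len cong: if_cong)
      ultimately show ?thesis using *(1) unfolding R_def by blast
    qed
    moreover have "0 \<le> T n" using *(2) by simp
    ultimately show ?thesis by blast
  qed
  then obtain w where w: "\<And>\<rho>. \<rho> \<in> ?Perms \<Longrightarrow> w \<rho> \<in> R \<and> index_edges n (w \<rho>) = ?G \<rho>"
  proof -
    have "\<forall>\<rho>\<in>?Perms. \<exists>im. im \<in> R \<and> index_edges n im = ?G \<rho>" using run by blast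
    from bchoice[OF this] show ?thesis using that by blast
  qed
  have "inj_on (\<lambda>\<rho>. (w \<rho>, \<rho> 0)) ?Perms"
  proof (rule inj_onI)
    fix \<rho> \<rho>' assume *: "\<rho> \<in> ?Perms" "\<rho>' \<in> ?Perms" "(w \<rho>, \<rho> 0) = (w \<rho>', \<rho>' 0)"
    then have "w \<rho> = w \<rho>'" by simp
    with w[OF *(1)] w[OF *(2)] have "?G \<rho> = ?G \<rho>'" by (simp only:)
    have perms: "\<rho> permutes {..<n}" "\<rho>' permutes {..<n}" using * by auto
    have "\<rho> 0 = \<rho>' 0" using *(3) by simp
    then have "\<rho> v = \<rho>' v" if "v < n" for v
      using permutation_of_edges_unique[OF permutes_inj_on[OF perms(1)] permutes_inj_on[OF perms(2)]
        _ \<open>?G \<rho> = ?G \<rho>'\<close> that] by blast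
    moreover have "\<rho> v = \<rho>' v" if "\<not> v < n" for v
      using that * by (auto simp: permutes_def)
    ultimately show "\<rho> = \<rho>'" by blast
  qed
  moreover have "(\<lambda>\<rho>. (w \<rho>, \<rho> 0)) ` ?Perms \<subseteq> R \<times> {..<n}"
    using w permutes_in_image n by fastforce
  ultimately have "card ?Perms \<le> card (R \<times> {..<n})"
    using R(1) by (intro card_inj_on_le[of "\<lambda>\<rho>. (w \<rho>, \<rho> 0)"]) auto
  then have "fact n \<le> card R * n"
    using card_permutations[of "{..<n}" n] by (simp add: card_cartesian_product)
  also have "\<dots> \<le> 2 ^ \<tau> * n" using R(2) by simp
  finally have "n * fact (n - 1) \<le> 2 ^ \<tau> * n"
    using n by (simp add: fact_reduce)
  then have "fact (n - 1) \<le> (2 ^ \<tau> :: nat)" using n by simp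
  then have "real (fact (n - 1)) \<le> real (2 ^ \<tau>)" by (rule of_nat_mono)
  then have "fact (n - 1) \<le> (2 :: real) powr real \<tau>" by (simp add: powr_realpow)
  also have "\<dots> \<le> 2 powr T n"
    using run[OF permutes_id] by (intro powr_mono) (auto simp: \<tau>_def)
  finally show ?thesis .
qed

section \<open>Comparison of the running times\<close>

lemma ln_fact_lower:
  assumes "m > 0"
  shows "real m * ln (real m) - real m \<le> ln (fact m)"
proof -
  \<comment> \<open>The left side is a single term of the exponential series at
    \<open>m\<close>.\<close>
  have "real m ^ m /\<^sub>R fact m \<le> exp (real m)"
    unfolding exp_def using summable_exp_generic[of "real m"]
    by (intro order_trans[OF _ sum_le_suminf[of _ "{m}"]]) auto
  then have "real m ^ m \<le> exp (real m) * fact m"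
    by (simp add: field_simps)
  then have "ln (real m ^ m) \<le> ln (exp (real m) * fact m)"
    using assms by (subst ln_le_cancel_iff) auto
  then show ?thesis using assms by (simp add: ln_mult ln_realpow)
qed

lemma matching_time_constant: "real (k * (k + 4) + k + 17 + 8 * 3 ^ k) \<noteq> 0"
  by (simp only: of_nat_eq_0_iff)

text \<open>The factorial bound forces every time bound for spanning trees up to order
  \<open>n * ln n\<close>, the order of \<open>matching_time\<close>.\<close>

lemma matching_time_bigo_mst:
  assumes "computes_within q {n. n \<ge> 2} (euclidean_mst :: (real ^ 'k::finite) set \<Rightarrow> _) T"
  shows "matching_time k \<in> O(T)"
proof -
  let ?f = "\<lambda>n. real (n - 1) * ln (real (n - 1)) - real (n - 1)"
  have le: "?f n \<le> ln 2 * T n" if "n \<ge> 2" for n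
  proof -
    have "?f n \<le> ln (fact (n - 1))" using ln_fact_lower[of "n - 1"] that by simp
    also have "\<dots> \<le> ln (2 powr T n)"
      using mst_time_lower_bound[OF assms that] by (subst ln_le_cancel_iff) auto
    finally show ?thesis by (simp add: ln_powr mult.commute)
  qed
  \<comment> \<open>For small \<open>n\<close> the lower bound is negative, so absolute values are
    compared only from some point on.\<close>
  have "eventually (\<lambda>n. 0 \<le> ?f n) at_top" by real_asymp
  then have "eventually (\<lambda>n. norm (?f n) \<le> ln 2 * norm (T n)) at_top"
    using eventually_ge_at_top[of 2]
  proof eventually_elim
    case (elim n)
    have "ln 2 * T n \<le> ln 2 * norm (T n)" by (intro mult_left_mono) auto
    moreover have "norm (?f n) = ?f n" using elim(1) by (simp only: real_norm_def abs_of_nonneg)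
    ultimately show ?case using le[OF elim(2)] by linarith
  qed
  then have "?f \<in> O(T)" by (rule bigoI)
  moreover have "(\<lambda>n. real n * (1 + log 2 (real n))) \<in> O(?f)" by real_asymp
  then have "matching_time k \<in> O(?f)" unfolding matching_time_def 
    by (simp only: landau_o.big.cmult_in_iff[OF matching_time_constant])
  ultimately show ?thesis using landau_o.big_trans by blast
qed

lemma matching_time_subquadratic: "matching_time k \<in> o(\<lambda>n. real n ^ 2)"
proof -
  have "(\<lambda>n. real n * (1 + log 2 (real n))) \<in> o(\<lambda>n. real n ^ 2)" by real_asymp
  then show ?thesis unfolding matching_time_def 
    by (simp only: landau_o.small.cmult_in_iff[OF matching_time_constant])
qed

theorem corollary5p1:
  assumes "CARD('k::finite) \<ge> 3"
  shows "(\<forall>n (S :: (real ^ 'k) set).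
            n \<ge> 2 \<and> even n \<and> finite S \<and> card S = n \<and> S \<subseteq> unit_cube \<longrightarrow>
            (\<exists>M. perfect_matching S M \<and>
                 (\<Sum>e\<in>M. edge_length e ^ CARD('k)) powr (1 / real CARD('k))
                   \<le> 3 * sqrt 5 * (1 / 3) powr (1 / real CARD('k)) * sqrt (real CARD('k))))
       \<and> (\<forall>q T. computes_within q {n. n \<ge> 2} (euclidean_mst :: (real ^ 'k) set \<Rightarrow> _) T \<longrightarrow>
            (\<exists>p T'. computes_within p {n. n \<ge> 2 \<and> even n} (short_matching :: (real ^ 'k) set \<Rightarrow> _) T' \<and>
                    T' \<in> O(T)))
       \<and> (\<exists>p T. computes_within p {n. n \<ge> 2 \<and> even n} (short_matching :: (real ^ 'k) set \<Rightarrow> _) T \<and>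
                T \<in> o(\<lambda>n. real n ^ 2))"
proof (intro conjI allI impI)
  note computes = computes_short_matching[OF assms]
  fix n and S :: "(real ^ 'k) set"
  assume S: "n \<ge> 2 \<and> even n \<and> finite S \<and> card S = n \<and> S \<subseteq> unit_cube"
  \<comment> \<open>Existence is read off from a run of the program on any listing of the
    points.\<close>
  then obtain xs where xs: "set xs = S" "distinct xs" using finite_distinct_list by blast
  then have "length xs = n" using S distinct_card by fastforce
  with S xs have "distinct xs \<and> set xs \<subseteq> unit_cube \<and> length xs \<in> {n. n \<ge> 2 \<and> even n}" by simp
  from computes[unfolded computes_within_def, rule_format, OF this] obtain M where "short_matching S M"
    unfolding xs(1) by blast
  then show "\<exists>M. perfect_matching S M \<and>
      (\<Sum>e\<in>M. edge_length e ^ CARD('k)) powr (1 / real CARD('k))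
        \<le> 3 * sqrt 5 * (1 / 3) powr (1 / real CARD('k)) * sqrt (real CARD('k))"
    unfolding short_matching_def by blast
next
  \<comment> \<open>\<open>q\<close> is not run as a subroutine; its correctness shows that
    \<open>T\<close> grows fast enough.\<close>
  fix q T assume "computes_within q {n. n \<ge> 2} (euclidean_mst :: (real ^ 'k) set \<Rightarrow> _) T"
  then show "\<exists>p T'. computes_within p {n. n \<ge> 2 \<and> even n} (short_matching :: (real ^ 'k) set \<Rightarrow> _) T' \<and> T' \<in> O(T)"
    using computes_short_matching[OF assms] matching_time_bigo_mst by blast
next
  show "\<exists>p T. computes_within p {n. n \<ge> 2 \<and> even n} (short_matching :: (real ^ 'k) set \<Rightarrow> _) T \<and>
      T \<in> o(\<lambda>n. real n ^ 2)"
    using computes_short_matching[OF assms] matching_time_subquadratic by blast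
qed

end
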